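(* For every integer $n\ge 2$ there exists $\varepsilon_n>0$ such that every $1$-avoiding set $A\subseteq\mathbb{R}^n$ having block structure satisfies $$\overline{\delta}(A)\le \frac{1}{2^n}-\varepsilon_n .$$
   Context: A set $A\subseteq\mathbb{R}^n$ is called $1$-avoiding if $\|x-y\|\neq 1$ for all $x,y\in A$ (Euclidean norm). A set $A\subseteq\mathbb{R}^n$ has block structure if it is a union $A=\bigcup_{i=0}^\infty A_i$ of sets $A_i$ (called blocks) such that $\|x-y\|<1$ whenever $x$ and $y$ belong to the same block and $\|x-y\|>1$ whenever $x$ and $y$ belong to different blocks. The set $A$ is not required to be measurable. The upper density of an arbitrary set $A\subseteq\mathbb{R}^n$ is $$\overline{\delta}(A)=\limsup_{r\to\infty}\frac{\overline{\lambda}(A\cap S(p,r))}{\lambda(S(p,r))},$$ where $\lambda$ is Lebesgue measure, $\overline{\lambda}$ is Lebesgue outer measure, and $S(p,r)$ is the $n$-dimensional cube of side $2r$ centered at $p\in\mathbb{R}^n$ (the value does not depend on the choice of $p$). *)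

theory Defs
  imports "HOL-Analysis.Analysis"
begin

definition one_avoiding :: "(real^'n) set \<Rightarrow> bool" where
  "one_avoiding A \<longleftrightarrow> (\<forall>x\<in>A. \<forall>y\<in>A. dist x y \<noteq> 1)"

(* Blocks are allowed to be empty, so finite unions of blocks are covered;
   blocks with different indices count as different blocks. *)
definition has_block_structure :: "(real^'n) set \<Rightarrow> bool" where
  "has_block_structure A \<longleftrightarrow>
     (\<exists>B :: nat \<Rightarrow> (real^'n) set.
        A = (\<Union>i. B i) \<and>
        (\<forall>i. \<forall>x\<in>B i. \<forall>y\<in>B i. dist x y < 1) \<and>
        (\<forall>i j. i \<noteq> j \<longrightarrow> (\<forall>x\<in>B i. \<forall>y\<in>B j. dist x y > 1)))"

definition cube :: "real^'n \<Rightarrow> real \<Rightarrow> (real^'n) set" where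
  "cube p r = {x. \<forall>i. \<bar>x $ i - p $ i\<bar> \<le> r}"

(* The set need not be measurable, hence the outer measure. The value lies in [0, 1]; it is
   embedded into ereal rather than left in ennreal so that it can be compared with a
   difference of reals without truncation at 0. *)
definition upper_density_at :: "real^'n \<Rightarrow> (real^'n) set \<Rightarrow> ereal" where
  "upper_density_at p A =
     Limsup at_top (\<lambda>r::real. enn2ereal
       (outer_measure_of lebesgue (A \<inter> cube p r) / emeasure lebesgue (cube p r)))"

(* Centred at the origin; the choice of the centre is immaterial by upper_density_at_eq below. *)
definition upper_density :: "(real^'n) set \<Rightarrow> ereal" where
  "upper_density A = upper_density_at 0 A"

lemma cube_eq_cbox: "cube p r = cbox (p - (\<chi> i. r)) (p + (\<chi> i. r))"
  by (auto simp: cube_def mem_box_cart abs_le_iff algebra_simps)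

lemma emeasure_cube:
  fixes p :: "real^'n"
  assumes "r \<ge> 0"
  shows "emeasure lebesgue (cube p r) = ennreal ((2 * r) ^ CARD('n))"
proof -
  have ne: "cube p r \<noteq> {}"
    using assms by (auto simp: cube_def intro!: exI[of _ p])
  have "measure lborel (cube p r) = (2 * r) ^ CARD('n)"
    using ne unfolding cube_eq_cbox by (subst content_cbox_cart) auto
  moreover have "emeasure lborel (cube p r) = ennreal (measure lborel (cube p r))"
    unfolding cube_eq_cbox using emeasure_lborel_cbox_finite
    by (intro emeasure_eq_ennreal_measure) (auto simp: less_top)
  moreover have "emeasure lebesgue (cube p r) = emeasure lborel (cube p r)"
    unfolding cube_eq_cbox by simp
  ultimately show ?thesis by simp
qed

lemma outer_measure_cube_le:
  "outer_measure_of lebesgue (A \<inter> cube p r) \<le> emeasure lebesgue (cube p r)"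
proof -
  have "cube p r \<in> sets lebesgue" by (simp add: cube_eq_cbox)
  then show ?thesis
    using outer_measure_of_mono[of "A \<inter> cube p r" "cube p r" lebesgue] by simp
qed

lemma density_ratio_eq:
  fixes p :: "real^'n"
  assumes "r > 0"
  shows "enn2ereal (outer_measure_of lebesgue (A \<inter> cube p r) / emeasure lebesgue (cube p r))
    = ereal (enn2real (outer_measure_of lebesgue (A \<inter> cube p r)) / (2 * r) ^ CARD('n))"
proof -
  let ?o = "outer_measure_of lebesgue (A \<inter> cube p r)"
  have "?o < top"
    using outer_measure_cube_le[of A p r] emeasure_cube[of r p] assms
    by (simp add: le_less_trans[OF _ ennreal_less_top])
  then have o: "?o = ennreal (enn2real ?o)" by simp
  have "?o / emeasure lebesgue (cube p r) = ennreal (enn2real ?o / (2 * r) ^ CARD('n))"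
    using assms by (subst o) (simp add: emeasure_cube divide_ennreal)
  then show ?thesis using assms by (simp add: enn2ereal_ennreal)
qed

lemma upper_density_at_le:
  fixes p q :: "real^'n"
  shows "upper_density_at p A \<le> upper_density_at q A"
proof -
  let ?n = "CARD('n)"
  define m where "m c r = enn2real (outer_measure_of lebesgue (A \<inter> cube c r))"
    for c :: "real^'n" and r
  define d where "d = norm (p - q)"
  have d0: "d \<ge> 0" by (simp add: d_def)
  have sub: "cube p r \<subseteq> cube q (r + d)" for r
  proof
    fix x assume x: "x \<in> cube p r"
    have "\<bar>x $ i - q $ i\<bar> \<le> r + d" for i
    proof -
      have "\<bar>p $ i - q $ i\<bar> \<le> d" using component_le_norm_cart[of "p - q" i] by (simp add: d_def)
      moreover have "\<bar>x $ i - p $ i\<bar> \<le> r" using x by (simp add: cube_def)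
      ultimately show ?thesis by linarith
    qed
    then show "x \<in> cube q (r + d)" by (simp add: cube_def)
  qed
  have mono: "m p r \<le> m q (r + d)" if "r > 0" for r
  proof -
    have "outer_measure_of lebesgue (A \<inter> cube q (r + d)) < top"
      using outer_measure_cube_le[of A q "r + d"] emeasure_cube[of "r + d" q] that d0
      by (simp add: le_less_trans[OF _ ennreal_less_top])
    then show ?thesis unfolding m_def
      by (intro enn2real_mono outer_measure_of_mono) (use sub in auto)
  qed
  show ?thesis
    unfolding upper_density_at_def[of p] Limsup_le_iff
  proof (intro allI impI)
    fix y assume "upper_density_at q A < y"
    then obtain z where z: "upper_density_at q A < ereal z" "ereal z < y"
      using ereal_dense2 by blast
    have ev: "\<forall>\<^sub>F r in at_top. m q r / (2 * r) ^ ?n < z"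
    proof -
      have "\<forall>\<^sub>F r in at_top. enn2ereal (outer_measure_of lebesgue (A \<inter> cube q r) /
              emeasure lebesgue (cube q r)) < ereal z"
        using z(1) unfolding upper_density_at_def by (rule Limsup_lessD)
      then show ?thesis using eventually_gt_at_top[of 0]
        by eventually_elim (simp add: density_ratio_eq m_def)
    qed
    have ev': "\<forall>\<^sub>F r in at_top. m q (r + d) / (2 * (r + d)) ^ ?n < z"
    proof -
      obtain N where N: "\<And>r. r \<ge> N \<Longrightarrow> m q r / (2 * r) ^ ?n < z"
        using ev unfolding eventually_at_top_linorder by blast
      have "m q (r + d) / (2 * (r + d)) ^ ?n < z" if "r \<ge> N" for r
        using that d0 by (intro N) linarith
      then show ?thesis unfolding eventually_at_top_linorder by blast
    qed
    have "((\<lambda>r. 1 + d / r) \<longlongrightarrow> 1 + 0) at_top"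
      by (intro tendsto_add tendsto_const real_tendsto_divide_at_top[OF tendsto_const filterlim_ident])
    then have "((\<lambda>r. z * (1 + d / r) ^ ?n) \<longlongrightarrow> z * (1 + 0) ^ ?n) at_top"
      by (intro tendsto_mult tendsto_power tendsto_const)
    then have "((\<lambda>r. ereal (z * (1 + d / r) ^ ?n)) \<longlongrightarrow> ereal z) at_top" by simp
    then have "\<forall>\<^sub>F r in at_top. ereal (z * (1 + d / r) ^ ?n) < y"
      using z(2) by (rule order_tendstoD(2))
    then show "\<forall>\<^sub>F r in at_top. enn2ereal (outer_measure_of lebesgue (A \<inter> cube p r) /
              emeasure lebesgue (cube p r)) < y"
      using ev' eventually_gt_at_top[of 0]
    proof eventually_elim
      case (elim r)
      have "m p r / (2 * r) ^ ?n \<le> m q (r + d) / (2 * r) ^ ?n"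
        using mono elim(3) by (intro divide_right_mono) auto
      also have "\<dots> = m q (r + d) / (2 * (r + d)) ^ ?n * (1 + d / r) ^ ?n"
      proof -
        have "(2 * (r + d)) ^ ?n = (2 * r) ^ ?n * (1 + d / r) ^ ?n"
          unfolding power_mult_distrib[symmetric]
          by (rule arg_cong[where f = "\<lambda>t. t ^ ?n"]) (use elim(3) in \<open>simp add: field_simps\<close>)
        moreover have "1 + d / r > 0"
          using elim(3) d0 by (simp add: add_pos_nonneg)
        ultimately show ?thesis by simp
      qed
      also have "\<dots> \<le> z * (1 + d / r) ^ ?n"
        using elim(2,3) d0 by (intro mult_right_mono) auto
      finally have "ereal (m p r / (2 * r) ^ ?n) \<le> ereal (z * (1 + d / r) ^ ?n)" by simp
      also note elim(1)
      finally show ?case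
        unfolding density_ratio_eq[OF elim(3)] m_def .
    qed
  qed
qed

lemma upper_density_at_eq: "upper_density_at p A = upper_density A"
  unfolding upper_density_def by (intro antisym upper_density_at_le)

end

theory Submission
  imports Defs
begin

text \<open>Let \<open>n\<close> be the dimension, let \<open>A\<close> be the union of the blocks \<open>B i\<close>, and let \<open>N i\<close> be the open
neighbourhood of radius \<open>1 / 2\<close> of \<open>B i\<close>. Different blocks are more than 1 apart, so the sets \<open>N i\<close> are
disjoint. The bound is the product of two estimates.

First, each block fills at most the fraction \<open>1 / 2 ^ n\<close> of its neighbourhood
(\<open>outer_measure_expand_small_set\<close>). This comes from the inequality
\<open>|X + Y| \<ge> 2 ^ n * min |X| |Y|\<close> of Brunn-Minkowski type (\<open>sumset_measure_ge_min\<close>), used twice: with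
\<open>Y = - X\<close> it shows that a set of diameter at most 1 is no larger than a ball of radius \<open>1 / 2\<close>, and
then with such a ball for \<open>Y\<close> it bounds \<open>N i = B i + Y\<close> from below.

Second, the sets \<open>N i\<close> leave out a fixed proportion of space, and this gives the improvement over
\<open>1 / 2 ^ n\<close>. Any family of blocks, whatever their shapes, leaves in each
ball of radius 2 a point at distance at least \<open>11 / 20\<close> from all blocks
(\<open>exists_point_far_from_blocks\<close>). The reason is dimension theory. Three blocks cannot all come within
\<open>11 / 20\<close> of one point, so slightly enlarged neighbourhoods that covered the ball would be bounded sets
of which no three meet, and their nerve would be a graph. Mapping the ball to this graph by a partition
of unity moves points by less than 2, so by Brouwer's theorem the image contains a ball. But the
image lies in finitely many segments, which form a null set when \<open>n \<ge> 2\<close>.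

By averaging over the centres of the balls (\<open>emeasure_ge_of_uniform_local_bound\<close>), the gaps have
density at least \<open>(1 / 60) ^ n\<close>. Hence the upper density of \<open>A\<close> is at most
\<open>(1 - (1 / 60) ^ n) / 2 ^ n\<close>.\<close>

section \<open>A Brunn-Minkowski inequality and the isodiametric inequality\<close>

lemma open_set_plus:
  fixes X Y :: "'a::real_normed_vector set"
  assumes "open X"
  shows "open (X + Y)"
proof -
  have "X + Y = (\<Union>x\<in>X. \<Union>y\<in>Y. {x + y})"
    by (auto simp: set_plus_def)
  then show ?thesis using open_sums[of X Y] assms by simp
qed

lemma bounded_set_plus:
  fixes X Y :: "'a::real_normed_vector set"
  assumes "bounded X" "bounded Y"
  shows "bounded (X + Y)"
proof -
  have "X + Y = (\<Union>x\<in>X. \<Union>y\<in>Y. {x + y})"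
    by (auto simp: set_plus_def)
  then show ?thesis using bounded_sums[OF assms] by simp
qed

text \<open>The measure of the part of \<open>Y\<close> below height \<open>s\<close> is a continuous function of \<open>s\<close>, because thin slabs
of a bounded box have small measure; hence the intermediate value theorem applies.\<close>

lemma halfspace_cut_exists:
  fixes Y :: "'a::euclidean_space set"
  assumes Y: "open Y" "bounded Y" and k: "k \<in> Basis"
    and v: "0 \<le> v" "v \<le> measure lebesgue Y"
  obtains s where "measure lebesgue (Y \<inter> {x. x \<bullet> k < s}) = v"
proof -
  define f where "f s = measure lebesgue (Y \<inter> {x. x \<bullet> k < s})" for s
  have op: "open (Y \<inter> {x. x \<bullet> k < s})" for s
    using Y by (intro open_Int open_halfspace_component_lt) auto
  have meas: "Y \<inter> {x. x \<bullet> k < s} \<in> lmeasurable" for s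
    using op Y by (intro lmeasurable_open) (auto intro: bounded_subset)
  obtain a b where ab: "Y \<subseteq> cbox a b"
    using bounded_subset_cbox_symmetric[OF Y(2)] by blast
  have slab: "cbox a b \<inter> {x. \<bar>x \<bullet> k - c\<bar> \<le> d} \<in> lmeasurable" for c d
  proof -
    have "closed {x. \<bar>x \<bullet> k - c\<bar> \<le> d}"
      by (intro closed_Collect_le continuous_intros)
    then show ?thesis by (intro lmeasurable_compact compact_Int_closed compact_cbox)
  qed
  have cont: "isCont f c" for c
    unfolding continuous_at_eps_delta
  proof (intro allI impI)
    fix e :: real assume "0 < e"
    from content_doublesplit[OF this k, of a b c] obtain d
      where d: "0 < d" "measure lebesgue (cbox a b \<inter> {x. \<bar>x \<bullet> k - c\<bar> \<le> d}) < e"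
      using slab[of c] by (auto simp: measure_completion)
    have "dist (f s) (f c) < e" if "dist s c < d" for s
    proof -
      have le: "f t \<le> f u + measure lebesgue (cbox a b \<inter> {x. \<bar>x \<bullet> k - c\<bar> \<le> d})"
        if "\<bar>t - c\<bar> \<le> d" "\<bar>u - c\<bar> \<le> d" for t u
      proof -
        have "Y \<inter> {x. x \<bullet> k < t} \<subseteq> (Y \<inter> {x. x \<bullet> k < u}) \<union> (cbox a b \<inter> {x. \<bar>x \<bullet> k - c\<bar> \<le> d})"
          using ab that by auto
        then have "f t \<le> measure lebesgue ((Y \<inter> {x. x \<bullet> k < u}) \<union> (cbox a b \<inter> {x. \<bar>x \<bullet> k - c\<bar> \<le> d}))"
          unfolding f_def using meas slab by (intro measure_mono_fmeasurable fmeasurable.Un) auto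
        also have "\<dots> \<le> f u + measure lebesgue (cbox a b \<inter> {x. \<bar>x \<bullet> k - c\<bar> \<le> d})"
          unfolding f_def using meas slab by (intro measure_Un_le) auto
        finally show ?thesis .
      qed
      show ?thesis using le[of s c] le[of c s] d that by (auto simp: dist_real_def)
    qed
    then show "\<exists>d>0. \<forall>x'. dist x' c < d \<longrightarrow> dist (f x') (f c) < e" using d(1) by blast
  qed
  obtain B where B: "\<And>x. x \<in> Y \<Longrightarrow> norm x \<le> B" "0 < B"
    using Y(2) bounded_pos by blast
  have xk: "\<bar>x \<bullet> k\<bar> \<le> B" if "x \<in> Y" for x
    using Basis_le_norm[OF k, of x] B(1)[OF that] by linarith
  have "Y \<inter> {x. x \<bullet> k < - B} = {}" "Y \<inter> {x. x \<bullet> k < B + 1} = Y"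
    using xk by force+
  then have "f (- B) = 0" "f (B + 1) = measure lebesgue Y" by (simp_all add: f_def)
  then have "\<exists>s\<ge>-B. s \<le> B + 1 \<and> f s = v"
    using v B(2) cont by (intro IVT) auto
  then show thesis using that by (auto simp: f_def)
qed

lemma measure_halfspace_split:
  fixes Y :: "'a::euclidean_space set"
  assumes Y: "open Y" "bounded Y" and k: "k \<in> Basis"
  shows "measure lebesgue Y =
    measure lebesgue (Y \<inter> {x. x \<bullet> k < s}) + measure lebesgue (Y \<inter> {x. x \<bullet> k > s})"
proof -
  have "negligible {x. x \<bullet> k = s}"
    using k negligible_hyperplane[of k s] by (auto simp: inner_commute)
  then have "measure lebesgue Y
      = measure lebesgue ((Y \<inter> {x. x \<bullet> k < s}) \<union> (Y \<inter> {x. x \<bullet> k > s}))"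
    using Y by (intro measure_negligible_symdiff[symmetric])
      (auto intro!: lmeasurable_open open_Int open_halfspace_component_lt open_halfspace_component_gt
        elim!: negligible_subset intro: bounded_subset)
  also have "\<dots> = measure lebesgue (Y \<inter> {x. x \<bullet> k < s}) + measure lebesgue (Y \<inter> {x. x \<bullet> k > s})"
  proof -
    have "(Y \<inter> {x. x \<bullet> k < s}) \<inter> (Y \<inter> {x. x \<bullet> k > s}) = {}" by auto
    then show ?thesis using Y
      by (subst measure_Un3)
        (auto intro!: lmeasurable_open open_Int open_halfspace_component_lt open_halfspace_component_gt
          intro: bounded_subset)
  qed
  finally show ?thesis .
qed

lemma box_plus_box:
  fixes a b c d :: "'a::euclidean_space"
  assumes "box a b \<noteq> {}" "box c d \<noteq> {}"
  shows "box (a + c) (b + d) \<subseteq> box a b + box c d"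
proof
  fix z assume z: "z \<in> box (a + c) (b + d)"
  have ab: "a \<bullet> i < b \<bullet> i" and cd: "c \<bullet> i < d \<bullet> i" if "i \<in> Basis" for i
    using assms that by (auto simp: box_ne_empty)
  \<comment> \<open>The relative position of \<open>z\<close> in the sum box; the summands take the same position in their boxes.\<close>
  define t where "t i = (z \<bullet> i - a \<bullet> i - c \<bullet> i) / ((b \<bullet> i - a \<bullet> i) + (d \<bullet> i - c \<bullet> i))" for i
  have t: "0 < t i" "t i < 1" 
    "z \<bullet> i = (a \<bullet> i + t i * (b \<bullet> i - a \<bullet> i)) + (c \<bullet> i + t i * (d \<bullet> i - c \<bullet> i))"
    if i: "i \<in> Basis" for i
  proof -
    have p: "(b \<bullet> i - a \<bullet> i) + (d \<bullet> i - c \<bullet> i) > 0" using ab cd i by smt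
    have "a \<bullet> i + c \<bullet> i < z \<bullet> i" "z \<bullet> i < b \<bullet> i + d \<bullet> i"
      using z i by (auto simp: mem_box inner_add_left)
    then show "0 < t i" "t i < 1" using p by (auto simp: t_def)
    have "t i * ((b \<bullet> i - a \<bullet> i) + (d \<bullet> i - c \<bullet> i)) = z \<bullet> i - a \<bullet> i - c \<bullet> i"
      using p by (simp add: t_def)
    then show "z \<bullet> i = (a \<bullet> i + t i * (b \<bullet> i - a \<bullet> i)) + (c \<bullet> i + t i * (d \<bullet> i - c \<bullet> i))"
      by (simp add: algebra_simps)
  qed
  define x where "x = (\<Sum>i\<in>Basis. (a \<bullet> i + t i * (b \<bullet> i - a \<bullet> i)) *\<^sub>R i)"
  define y where "y = (\<Sum>i\<in>Basis. (c \<bullet> i + t i * (d \<bullet> i - c \<bullet> i)) *\<^sub>R i)"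
  have conv: "p < p + u * (q - p) \<and> p + u * (q - p) < q" if "p < q" "0 < u" "u < 1" for p q u :: real
    using that mult_strict_right_mono[of u 1 "q - p"] by (simp add: algebra_simps)
  have "x \<in> box a b" "y \<in> box c d"
    using conv ab cd t by (auto simp: mem_box x_def y_def)
  moreover have "z = x + y"
    by (rule euclidean_eqI) (simp add: inner_add_left x_def y_def t(3)[symmetric])
  ultimately show "z \<in> box a b + box c d" by (auto simp: set_plus_def)
qed

text \<open>With side lengths \<open>p i\<close> and \<open>q i\<close> the sum of two boxes has side lengths \<open>p i + q i\<close>, and the
arithmetic-geometric mean inequality in every coordinate gives
\<open>\<Prod> (p i + q i) \<ge> 2 ^ n * sqrt (\<Prod> p i * \<Prod> q i)\<close>. This is the base case of the
Hadwiger-Ohmann induction.\<close>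

lemma measure_box_plus_box:
  fixes a b c d :: "'a::euclidean_space"
  assumes ne: "box a b \<noteq> {}" "box c d \<noteq> {}"
    and eq: "measure lebesgue (box a b) = measure lebesgue (box c d)"
  shows "2 ^ DIM('a) * measure lebesgue (box a b) \<le> measure lebesgue (box a b + box c d)"
proof -
  have ab: "a \<bullet> i < b \<bullet> i" and cd: "c \<bullet> i < d \<bullet> i" if "i \<in> Basis" for i
    using ne that by (auto simp: box_ne_empty)
  define p where "p i = b \<bullet> i - a \<bullet> i" for i
  define q where "q i = d \<bullet> i - c \<bullet> i" for i
  have p: "p i > 0" and q: "q i > 0" if "i \<in> Basis" for i
    using ab[OF that] cd[OF that] by (auto simp: p_def q_def)
  have mp: "measure lebesgue (box a b) = (\<Prod>i\<in>Basis. p i)"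
    using ab by (subst measure_completion) (auto simp: p_def measure_lborel_box_eq inner_diff_left less_imp_le intro!: prod.cong)
  have mq: "measure lebesgue (box c d) = (\<Prod>i\<in>Basis. q i)"
    using cd by (subst measure_completion) (auto simp: q_def measure_lborel_box_eq inner_diff_left less_imp_le)
  have sqrt_prod_aux: "sqrt (\<Prod>i\<in>S. f i) = (\<Prod>i\<in>S. sqrt (f i))" for S :: "'a set" and f
    by (induction S rule: infinite_finite_induct) (auto simp: real_sqrt_mult)
  have "2 ^ DIM('a) * measure lebesgue (box a b) = 2 ^ DIM('a) * sqrt ((\<Prod>i\<in>Basis. p i) * (\<Prod>i\<in>Basis. q i))"
    using eq prod_nonneg[of Basis p] p by (simp add: mp mq less_imp_le)
  also have "\<dots> = (\<Prod>i\<in>Basis. 2 * sqrt (p i * q i))"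
    by (simp add: prod.distrib real_sqrt_mult sqrt_prod_aux)
  also have "\<dots> \<le> (\<Prod>i\<in>Basis. p i + q i)"
  proof (rule prod_mono)
    fix i :: 'a assume "i \<in> Basis"
    then show "0 \<le> 2 * sqrt (p i * q i) \<and> 2 * sqrt (p i * q i) \<le> p i + q i"
      using p q arith_geo_mean_sqrt[of "p i" "q i"] by (auto simp: less_imp_le)
  qed
  also have "\<dots> = measure lebesgue (box (a + c) (b + d))"
    using ab cd by (subst measure_completion)
      (auto simp: p_def q_def measure_lborel_box_eq inner_diff_left inner_add_left less_imp_le add_mono algebra_simps intro!: prod.cong)
  also have "\<dots> \<le> measure lebesgue (box a b + box c d)"
    using box_plus_box[OF ne]
    by (intro measure_mono_fmeasurable)
       (auto intro!: lmeasurable_open open_set_plus bounded_set_plus bounded_box)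
  finally show ?thesis .
qed

definition box_family :: "'a::euclidean_space set set \<Rightarrow> bool" where
  "box_family \<X> \<longleftrightarrow> finite \<X> \<and> {} \<notin> \<X> \<and> disjoint \<X> \<and> (\<forall>Q\<in>\<X>. \<exists>a b. Q = box a b)"

lemma box_family_open: "box_family \<X> \<Longrightarrow> open (\<Union>\<X>)"
  unfolding box_family_def by (intro open_Union) (metis open_box)

lemma box_family_bounded: "box_family \<X> \<Longrightarrow> bounded (\<Union>\<X>)"
  unfolding box_family_def by (metis bounded_Union bounded_box)

lemma box_family_lmeasurable: "box_family \<X> \<Longrightarrow> \<Union>\<X> \<in> lmeasurable"
  using box_family_open box_family_bounded lmeasurable_open by blast

lemma box_Int_halfspace:
  fixes a b :: "'a::euclidean_space"
  assumes k: "k \<in> Basis"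
  shows "\<exists>c d. box a b \<inter> {x. x \<bullet> k < s} = box c d" "\<exists>c d. box a b \<inter> {x. x \<bullet> k > s} = box c d"
proof -
  have "box a b \<inter> {x. x \<bullet> k < s} = box a (\<Sum>i\<in>Basis. (if i = k then min (b \<bullet> k) s else b \<bullet> i) *\<^sub>R i)"
    using k by (auto simp: mem_box split: if_splits)
  then show "\<exists>c d. box a b \<inter> {x. x \<bullet> k < s} = box c d" by blast
  have "box a b \<inter> {x. x \<bullet> k > s} = box (\<Sum>i\<in>Basis. (if i = k then max (a \<bullet> k) s else a \<bullet> i) *\<^sub>R i) b"
    using k by (auto simp: mem_box split: if_splits)
  then show "\<exists>c d. box a b \<inter> {x. x \<bullet> k > s} = box c d" by blast
qed

text \<open>Cutting with a half-space \<open>H\<close> yields at most one box for every box that meets \<open>H\<close>. The bound on the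
number of boxes is what makes the induction below terminate.\<close>

lemma box_family_cut:
  assumes X: "box_family \<X>" and H: "\<And>a b. \<exists>c d. box a b \<inter> H = box c d"
  obtains \<X>' where "box_family \<X>'" "\<Union>\<X>' = \<Union>\<X> \<inter> H" "card \<X>' \<le> card {Q \<in> \<X>. Q \<inter> H \<noteq> {}}"
proof
  let ?X = "(\<lambda>Q. Q \<inter> H) ` {Q \<in> \<X>. Q \<inter> H \<noteq> {}}"
  have fin: "finite \<X>" using X by (simp add: box_family_def)
  have disj: "P \<inter> Q = {}" if "P \<in> \<X>" "Q \<in> \<X>" "P \<noteq> Q" for P Q
    using X that by (auto simp: box_family_def disjoint_def)
  have "disjoint ?X"
  proof (rule disjointI)
    fix P Q assume "P \<in> ?X" "Q \<in> ?X" "P \<noteq> Q"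
    then obtain P' Q' where "P' \<in> \<X>" "Q' \<in> \<X>" "P = P' \<inter> H" "Q = Q' \<inter> H" by auto
    then show "P \<inter> Q = {}" using disj[of P' Q'] \<open>P \<noteq> Q\<close> by auto
  qed
  moreover have "\<exists>a b. Q = box a b" if Q: "Q \<in> ?X" for Q
  proof -
    obtain P where P: "P \<in> \<X>" "Q = P \<inter> H" using Q by auto
    then obtain a b where "P = box a b" using X by (auto simp: box_family_def)
    then show ?thesis using H[of a b] P by simp
  qed
  ultimately show "box_family ?X"
    using fin by (auto simp: box_family_def)
  show "\<Union>?X = \<Union>\<X> \<inter> H" by auto
  show "card ?X \<le> card {Q \<in> \<X>. Q \<inter> H \<noteq> {}}" using fin by (intro card_image_le) auto
qed

lemma disjoint_boxes_separated:
  fixes P Q :: "'a::euclidean_space set"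
  assumes "P = box a b" "Q = box c d" "P \<noteq> {}" "Q \<noteq> {}" "P \<inter> Q = {}"
  obtains k t where "k \<in> Basis" 
    "P \<subseteq> {x. x \<bullet> k < t} \<and> Q \<subseteq> {x. x \<bullet> k > t} \<or> Q \<subseteq> {x. x \<bullet> k < t} \<and> P \<subseteq> {x. x \<bullet> k > t}"
proof -
  have ne: "\<forall>i\<in>Basis. a \<bullet> i < b \<bullet> i" "\<forall>i\<in>Basis. c \<bullet> i < d \<bullet> i"
    using assms(1-4) by (simp_all add: box_ne_empty)
  have "box a b \<inter> box c d = {}" using assms by simp
  then obtain i where "i \<in> Basis" "b \<bullet> i \<le> a \<bullet> i \<or> d \<bullet> i \<le> c \<bullet> i \<or> b \<bullet> i \<le> c \<bullet> i \<or> d \<bullet> i \<le> a \<bullet> i"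
    unfolding disjoint_interval(4) by blast
  with ne have i: "i \<in> Basis" "b \<bullet> i \<le> c \<bullet> i \<or> d \<bullet> i \<le> a \<bullet> i"
    by (auto simp: not_le[symmetric])
  from i(2) show thesis
  proof
    assume le: "b \<bullet> i \<le> c \<bullet> i"
    have "P \<subseteq> {x. x \<bullet> i < b \<bullet> i}" "Q \<subseteq> {x. x \<bullet> i > b \<bullet> i}"
      using assms(1,2) i(1) le by (auto simp: mem_box intro: le_less_trans)
    then show thesis using i(1) that by blast
  next
    assume le: "d \<bullet> i \<le> a \<bullet> i"
    have "Q \<subseteq> {x. x \<bullet> i < d \<bullet> i}" "P \<subseteq> {x. x \<bullet> i > d \<bullet> i}"
      using assms(1,2) i(1) le by (auto simp: mem_box intro: le_less_trans)
    then show thesis using i(1) that by blast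
  qed
qed

text \<open>The sums of corresponding parts lie on different sides of the hyperplane at height \<open>t + s\<close>, so no
point of \<open>X + Y\<close> is counted twice.\<close>

lemma measure_sumset_split:
  fixes X Y :: "'a::euclidean_space set"
  assumes X: "open X" "bounded X" and Y: "open Y" "bounded Y" and k: "k \<in> Basis"
  shows "measure lebesgue ((X \<inter> {x. x \<bullet> k < t}) + (Y \<inter> {x. x \<bullet> k < s}))
       + measure lebesgue ((X \<inter> {x. x \<bullet> k > t}) + (Y \<inter> {x. x \<bullet> k > s}))
       \<le> measure lebesgue (X + Y)" (is "measure _ ?L + measure _ ?R \<le> _")
proof -
  have o: "open (X \<inter> {x. x \<bullet> k < t})" "open (X \<inter> {x. x \<bullet> k > t})"
    using X by (auto intro!: open_Int open_halfspace_component_lt open_halfspace_component_gt)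
  have b: "bounded (Z \<inter> W)" if "bounded Z" for Z W :: "'a set"
    using that by (auto intro: bounded_subset)
  have LR: "?L \<in> lmeasurable" "?R \<in> lmeasurable" "X + Y \<in> lmeasurable"
    using X Y by (auto intro!: lmeasurable_open open_set_plus bounded_set_plus b o)
  have "?L \<inter> ?R = {}"
  proof -
    have "z \<bullet> k < t + s" if "z \<in> ?L" for z
      using that by (auto simp: set_plus_def inner_add_left)
    moreover have "z \<bullet> k > t + s" if "z \<in> ?R" for z
      using that by (auto simp: set_plus_def inner_add_left)
    ultimately show ?thesis by fastforce
  qed
  then have "measure lebesgue ?L + measure lebesgue ?R = measure lebesgue (?L \<union> ?R)"
    using LR by (subst measure_Un3) auto
  also have "\<dots> \<le> measure lebesgue (X + Y)"
    using LR by (intro measure_mono_fmeasurable) (auto simp: set_plus_def fmeasurableD)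
  finally show ?thesis .
qed

text \<open>The Hadwiger-Ohmann induction on the total number of boxes. If one family has two boxes, a coordinate
hyperplane separates them; cut the other union by a parallel hyperplane so that the two lower parts
have equal measure, and therefore the two upper parts too. Restricting the claim to unions of equal
measure keeps the induction hypothesis applicable to both pairs of parts, and no roots of measures
have to be handled.\<close>

lemma sumset_measure_equal_box_families:
  fixes \<X> \<Y> :: "'a::euclidean_space set set"
  assumes "box_family \<X>" "box_family \<Y>" "measure lebesgue (\<Union>\<X>) = measure lebesgue (\<Union>\<Y>)"
  shows "2 ^ DIM('a) * measure lebesgue (\<Union>\<X>) \<le> measure lebesgue (\<Union>\<X> + \<Union>\<Y>)"
  using assms
proof (induction "card \<X> + card \<Y>" arbitrary: \<X> \<Y> rule: less_induct)
  case less
  have step: "2 ^ DIM('a) * measure lebesgue (\<Union>\<P>) \<le> measure lebesgue (\<Union>\<P> + \<Union>\<Q>)"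
    if P: "box_family \<P>" and Q: "box_family \<Q>" and eq: "measure lebesgue (\<Union>\<P>) = measure lebesgue (\<Union>\<Q>)"
      and card: "card \<P> + card \<Q> = card \<X> + card \<Y>" and two: "A \<in> \<P>" "B \<in> \<P>" "A \<noteq> B"
    for \<P> \<Q> :: "'a set set" and A B
  proof -
    note Po = box_family_open[OF P] box_family_bounded[OF P]
    note Qo = box_family_open[OF Q] box_family_bounded[OF Q]
    have finP: "finite \<P>" "finite \<Q>" using P Q by (auto simp: box_family_def)
    obtain a b c d where AB: "A = box a b" "B = box c d" "A \<noteq> {}" "B \<noteq> {}" "A \<inter> B = {}"
      using P two unfolding box_family_def disjoint_def by metis
    obtain k t where k: "k \<in> Basis"
      and sep: "A \<subseteq> {x. x \<bullet> k < t} \<and> B \<subseteq> {x. x \<bullet> k > t} \<or> B \<subseteq> {x. x \<bullet> k < t} \<and> A \<subseteq> {x. x \<bullet> k > t}"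
      by (rule disjoint_boxes_separated[OF AB])
    obtain Pl where Pl: "box_family Pl" "\<Union>Pl = \<Union>\<P> \<inter> {x. x \<bullet> k < t}"
        "card Pl \<le> card {Q \<in> \<P>. Q \<inter> {x. x \<bullet> k < t} \<noteq> {}}"
      using box_family_cut[OF P box_Int_halfspace(1)[OF k]] by blast
    obtain Pr where Pr: "box_family Pr" "\<Union>Pr = \<Union>\<P> \<inter> {x. x \<bullet> k > t}"
        "card Pr \<le> card {Q \<in> \<P>. Q \<inter> {x. x \<bullet> k > t} \<noteq> {}}"
      using box_family_cut[OF P box_Int_halfspace(2)[OF k]] by blast
    \<comment> \<open>Each half-space misses one of the two separated boxes, so both halves consist of fewer boxes.\<close>
    have lt: "C \<inter> {x. x \<bullet> k < t} = {}" if "C \<subseteq> {x. x \<bullet> k > t}" for C using that by force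
    have gt: "C \<inter> {x. x \<bullet> k > t} = {}" if "C \<subseteq> {x. x \<bullet> k < t}" for C using that by force
    have "\<exists>C\<in>\<P>. C \<inter> {x. x \<bullet> k < t} = {}" "\<exists>C\<in>\<P>. C \<inter> {x. x \<bullet> k > t} = {}"
      using sep two(1,2) lt gt by metis+
    then have "{Q \<in> \<P>. Q \<inter> {x. x \<bullet> k < t} \<noteq> {}} \<subset> \<P>" "{Q \<in> \<P>. Q \<inter> {x. x \<bullet> k > t} \<noteq> {}} \<subset> \<P>"
      by auto
    then have "card {Q \<in> \<P>. Q \<inter> {x. x \<bullet> k < t} \<noteq> {}} < card \<P>" "card {Q \<in> \<P>. Q \<inter> {x. x \<bullet> k > t} \<noteq> {}} < card \<P>"
      using psubset_card_mono[OF finP(1)] by simp_all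
    then have cP: "card Pl < card \<P>" "card Pr < card \<P>"
      using Pl(3) Pr(3) by linarith+
    have "measure lebesgue (\<Union>Pl) \<le> measure lebesgue (\<Union>\<P>)"
      using Pl(2) box_family_lmeasurable[OF Pl(1)] box_family_lmeasurable[OF P]
      by (intro measure_mono_fmeasurable fmeasurableD) auto
    then obtain s where s: "measure lebesgue (\<Union>\<Q> \<inter> {x. x \<bullet> k < s}) = measure lebesgue (\<Union>Pl)"
      by (metis halfspace_cut_exists[OF Qo k] eq measure_nonneg)
    obtain Ql where Ql: "box_family Ql" "\<Union>Ql = \<Union>\<Q> \<inter> {x. x \<bullet> k < s}"
        "card Ql \<le> card {Q \<in> \<Q>. Q \<inter> {x. x \<bullet> k < s} \<noteq> {}}"
      using box_family_cut[OF Q box_Int_halfspace(1)[OF k]] by blast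
    obtain Qr where Qr: "box_family Qr" "\<Union>Qr = \<Union>\<Q> \<inter> {x. x \<bullet> k > s}"
        "card Qr \<le> card {Q \<in> \<Q>. Q \<inter> {x. x \<bullet> k > s} \<noteq> {}}"
      using box_family_cut[OF Q box_Int_halfspace(2)[OF k]] by blast
    have "card {Q \<in> \<Q>. Q \<inter> {x. x \<bullet> k < s} \<noteq> {}} \<le> card \<Q>" "card {Q \<in> \<Q>. Q \<inter> {x. x \<bullet> k > s} \<noteq> {}} \<le> card \<Q>"
      using finP by (auto intro!: card_mono)
    then have cQ: "card Ql \<le> card \<Q>" "card Qr \<le> card \<Q>" using Ql(3) Qr(3) by linarith+
    have splitP: "measure lebesgue (\<Union>\<P>) = measure lebesgue (\<Union>Pl) + measure lebesgue (\<Union>Pr)"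
      using measure_halfspace_split[OF Po k, of t] Pl(2) Pr(2) by simp
    have splitQ: "measure lebesgue (\<Union>\<Q>) = measure lebesgue (\<Union>Ql) + measure lebesgue (\<Union>Qr)"
      using measure_halfspace_split[OF Qo k, of s] Ql(2) Qr(2) by simp
    have eql: "measure lebesgue (\<Union>Pl) = measure lebesgue (\<Union>Ql)" using s Ql(2) by simp
    have eqr: "measure lebesgue (\<Union>Pr) = measure lebesgue (\<Union>Qr)"
      using splitP splitQ eq eql by simp
    have "2 ^ DIM('a) * measure lebesgue (\<Union>\<P>)
        = 2 ^ DIM('a) * measure lebesgue (\<Union>Pl) + 2 ^ DIM('a) * measure lebesgue (\<Union>Pr)"
      using splitP by (simp only: distrib_left)
    also have "\<dots> \<le> measure lebesgue (\<Union>Pl + \<Union>Ql) + measure lebesgue (\<Union>Pr + \<Union>Qr)"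
      using less.hyps[OF _ Pl(1) Ql(1) eql] less.hyps[OF _ Pr(1) Qr(1) eqr] cP cQ card
      by (intro add_mono) auto
    also have "\<dots> \<le> measure lebesgue (\<Union>\<P> + \<Union>\<Q>)"
      using measure_sumset_split[OF Po Qo k, of t s] Pl(2) Pr(2) Ql(2) Qr(2) by simp
    finally show ?thesis .
  qed
  have fin: "finite \<X>" "finite \<Y>" using less.prems by (auto simp: box_family_def)
  \<comment> \<open>The step is asymmetric in the two families; commutativity of the sum covers the other case.\<close>
  consider "\<X> = {} \<or> \<Y> = {}" | A B where "A \<in> \<X>" "B \<in> \<X>" "A \<noteq> B" 
    | A B where "A \<in> \<Y>" "B \<in> \<Y>" "A \<noteq> B" | A B where "\<X> = {A}" "\<Y> = {B}"
    by (metis (no_types, lifting) equals0I insertI1 is_singletonI' is_singleton_def)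
  then show ?case
  proof cases
    case 1
    then have "measure lebesgue (\<Union>\<X>) = 0" using less.prems(3) by auto
    then show ?thesis by simp
  next
    case 2
    then show ?thesis using step[of \<X> \<Y>] less.prems by simp
  next
    case 3
    then show ?thesis using step[of \<Y> \<X>] less.prems by (simp add: add.commute)
  next
    case 4
    then have "A \<noteq> {}" "B \<noteq> {}" "\<exists>a b. A = box a b" "\<exists>c d. B = box c d"
      using less.prems(1,2) by (auto simp: box_family_def)
    then obtain a b c d where "A = box a b" "B = box c d" "A \<noteq> {}" "B \<noteq> {}"
      by metis
    then show ?thesis using less.prems(3) 4 measure_box_plus_box[of a b c d] by simp
  qed
qed

lemma compact_covered_by_cboxes:
  fixes K U :: "'a::euclidean_space set"
  assumes "compact K" "open U" "K \<subseteq> U"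
  obtains \<F> where "finite \<F>" "\<And>Q. Q \<in> \<F> \<Longrightarrow> \<exists>a b. Q = cbox a b" "K \<subseteq> \<Union>\<F>" "\<Union>\<F> \<subseteq> U"
proof -
  have "\<exists>a b. x \<in> box a b \<and> cbox a b \<subseteq> U" if "x \<in> K" for x
    using open_contains_cbox assms(2,3) that by (metis subsetD)
  then obtain a b where ab: "\<And>x. x \<in> K \<Longrightarrow> x \<in> box (a x) (b x) \<and> cbox (a x) (b x) \<subseteq> U"
    by metis
  obtain D where D: "D \<subseteq> K" "finite D" "K \<subseteq> (\<Union>x\<in>D. box (a x) (b x))"
  proof (rule compactE_image[OF assms(1), of K "\<lambda>x. box (a x) (b x)"])
    show "K \<subseteq> (\<Union>c\<in>K. box (a c) (b c))" using ab by blast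
  qed (auto intro: that)
  show thesis
  proof (rule that[of "(\<lambda>x. cbox (a x) (b x)) ` D"])
    show "K \<subseteq> \<Union> ((\<lambda>x. cbox (a x) (b x)) ` D)"
      using D(3) box_subset_cbox by fastforce
  qed (use ab D in auto)
qed

text \<open>Inner regularity gives a compact set that exhausts most of \<open>U\<close>. It is covered by finitely many closed
boxes inside \<open>U\<close>; subdividing them into boxes with disjoint interiors and dropping the boundaries
costs no measure.\<close>

lemma open_approx_box_family:
  fixes U :: "'a::euclidean_space set"
  assumes U: "open U" "bounded U" and v: "v < measure lebesgue U"
  obtains \<X> where "box_family \<X>" "\<Union>\<X> \<subseteq> U" "v < measure lebesgue (\<Union>\<X>)"
proof -
  have Um: "U \<in> lmeasurable" using U by (intro lmeasurable_open)
  obtain K where K: "closed K" "K \<subseteq> U" "U - K \<in> lmeasurable"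
      "emeasure lebesgue (U - K) < ennreal (measure lebesgue U - v)"
    using sets_lebesgue_inner_closed[of U "measure lebesgue U - v"] Um v by (auto simp: fmeasurableD)
  have Kc: "compact K"
    using K(1,2) U(2) bounded_subset compact_eq_bounded_closed by blast
  have "measure lebesgue (U - K) < measure lebesgue U - v"
    using K(3,4) v by (simp add: emeasure_eq_measure2 ennreal_less_iff)
  moreover have "measure lebesgue U \<le> measure lebesgue (U - K) + measure lebesgue K"
  proof -
    have "measure lebesgue ((U - K) \<union> K) \<le> measure lebesgue (U - K) + measure lebesgue K"
      using K(3) lmeasurable_compact[OF Kc] by (intro measure_Un_le fmeasurableD)
    moreover have "(U - K) \<union> K = U" using K(2) by blast
    ultimately show ?thesis by simp
  qed
  ultimately have Kv: "v < measure lebesgue K" by linarith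
  obtain \<F> where F: "finite \<F>" "\<And>Q. Q \<in> \<F> \<Longrightarrow> \<exists>a b. Q = cbox a b" "K \<subseteq> \<Union>\<F>" "\<Union>\<F> \<subseteq> U"
    using compact_covered_by_cboxes[OF Kc U(1) K(2)] by metis
  obtain p where p: "p division_of \<Union>\<F>"
    using elementary_unions_intervals[OF F(1,2)] by metis
  have pfin: "finite p" and pU: "\<Union>p = \<Union>\<F>" 
    and pbox: "\<And>Q. Q \<in> p \<Longrightarrow> \<exists>a b. Q = cbox a b"
    and pdis: "\<And>P Q. P \<in> p \<Longrightarrow> Q \<in> p \<Longrightarrow> P \<noteq> Q \<Longrightarrow> interior P \<inter> interior Q = {}"
    using p unfolding division_of_def by auto
  define \<X> where "\<X> = interior ` p - {{}}"
  have X: "box_family \<X>"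
    unfolding box_family_def
  proof (intro conjI ballI)
    show "finite \<X>" "{} \<notin> \<X>" using pfin by (auto simp: \<X>_def)
    show "disjoint \<X>"
    proof (rule disjointI)
      fix P Q assume "P \<in> \<X>" "Q \<in> \<X>" "P \<noteq> Q"
      then obtain P' Q' where "P' \<in> p" "Q' \<in> p" "P = interior P'" "Q = interior Q'"
        by (auto simp: \<X>_def)
      then show "P \<inter> Q = {}" using pdis[of P' Q'] \<open>P \<noteq> Q\<close> by auto
    qed
    fix Q assume "Q \<in> \<X>"
    then obtain P where "P \<in> p" "Q = interior P" by (auto simp: \<X>_def)
    then show "\<exists>a b. Q = box a b" using pbox[of P] interior_cbox by metis
  qed
  have UX: "\<Union>\<X> = (\<Union>P\<in>p. interior P)" by (auto simp: \<X>_def)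
  have XU: "\<Union>\<X> \<subseteq> U" using UX pU F(4) interior_subset by blast
  have neg: "negligible (\<Union>P\<in>p. P - interior P)"
  proof (rule negligible_Union)
    show "finite ((\<lambda>P. P - interior P) ` p)" using pfin by simp
    fix R assume "R \<in> (\<lambda>P. P - interior P) ` p"
    then obtain P where P: "P \<in> p" "R = P - interior P" by blast
    then obtain a b where "P = cbox a b" using pbox by blast
    then show "negligible R"
      using negligible_frontier_interval[of a b] P(2) by simp
  qed
  moreover have "K \<subseteq> \<Union>\<X> \<union> (\<Union>P\<in>p. P - interior P)" 
  proof
    fix x assume "x \<in> K"
    then obtain P where "P \<in> p" "x \<in> P" using F(3) pU by blast
    then show "x \<in> \<Union>\<X> \<union> (\<Union>P\<in>p. P - interior P)" unfolding UX by blast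
  qed
  ultimately have "measure lebesgue K \<le> measure lebesgue (\<Union>\<X> \<union> (\<Union>P\<in>p. P - interior P))"
    using Kc box_family_lmeasurable[OF X] negligible_imp_measurable[OF neg]
    by (intro measure_mono_fmeasurable fmeasurable.Un) (auto intro: fmeasurableD lmeasurable_compact)
  also have "\<dots> = measure lebesgue (\<Union>\<X>)"
  proof (rule measure_negligible_symdiff)
    show "negligible (sym_diff (\<Union>\<X>) (\<Union>\<X> \<union> (\<Union>P\<in>p. P - interior P)))"
      by (rule negligible_subset[OF neg]) blast
  qed (rule box_family_lmeasurable[OF X])
  finally show thesis using that X XU Kv by simp
qed

lemma open_contains_box_family_of_measure:
  fixes U :: "'a::euclidean_space set"
  assumes U: "open U" "bounded U" and v: "0 \<le> v" "v < measure lebesgue U"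
  obtains \<X> where "box_family \<X>" "\<Union>\<X> \<subseteq> U" "measure lebesgue (\<Union>\<X>) = v"
proof -
  obtain \<Y> where Y: "box_family \<Y>" "\<Union>\<Y> \<subseteq> U" "v < measure lebesgue (\<Union>\<Y>)"
    using open_approx_box_family[OF U v(2)] .
  obtain k :: 'a where k: "k \<in> Basis" using nonempty_Basis by blast
  obtain s where s: "measure lebesgue (\<Union>\<Y> \<inter> {x. x \<bullet> k < s}) = v"
    by (rule halfspace_cut_exists[OF box_family_open[OF Y(1)] box_family_bounded[OF Y(1)] k v(1)
          less_imp_le[OF Y(3)]])
  obtain \<X> where X: "box_family \<X>" "\<Union>\<X> = \<Union>\<Y> \<inter> {x. x \<bullet> k < s}"
    by (rule box_family_cut[OF Y(1) box_Int_halfspace(1)[OF k]])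
  have "\<Union>\<X> \<subseteq> U" using X(2) Y(2) by blast
  then show thesis using that[OF X(1)] X(2) s by simp
qed

text \<open>A form of the Brunn-Minkowski inequality that follows from the case of equal measures by exhausting
both sets from inside by box families of one common measure.\<close>

lemma sumset_measure_ge_min:
  fixes X Y :: "'a::euclidean_space set"
  assumes X: "open X" "bounded X" and Y: "open Y" "bounded Y"
  shows "2 ^ DIM('a) * min (measure lebesgue X) (measure lebesgue Y) \<le> measure lebesgue (X + Y)"
proof (rule ccontr)
  assume "\<not> ?thesis"
  then have "measure lebesgue (X + Y) / 2 ^ DIM('a) < min (measure lebesgue X) (measure lebesgue Y)"
    by (simp only: not_le pos_divide_less_eq zero_less_power zero_less_numeral mult.commute)
  then obtain v where v: "measure lebesgue (X + Y) / 2 ^ DIM('a) < v"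
      "v < min (measure lebesgue X) (measure lebesgue Y)"
    using dense by blast
  have v0: "0 \<le> v" using v(1) by (smt (verit) divide_nonneg_nonneg measure_nonneg zero_le_power)
  obtain \<X> where P: "box_family \<X>" "\<Union>\<X> \<subseteq> X" "measure lebesgue (\<Union>\<X>) = v"
    using open_contains_box_family_of_measure[OF X v0] v(2) by auto
  obtain \<Y> where Q: "box_family \<Y>" "\<Union>\<Y> \<subseteq> Y" "measure lebesgue (\<Union>\<Y>) = v"
    using open_contains_box_family_of_measure[OF Y v0] v(2) by auto
  have "2 ^ DIM('a) * v \<le> measure lebesgue (\<Union>\<X> + \<Union>\<Y>)"
    using sumset_measure_equal_box_families[OF P(1) Q(1)] P(3) Q(3) by simp
  also have "\<dots> \<le> measure lebesgue (X + Y)"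
    using P Q X Y
    by (intro measure_mono_fmeasurable set_plus_mono2 fmeasurableD lmeasurable_open open_set_plus bounded_set_plus
        box_family_open box_family_bounded)
  finally have "2 ^ DIM('a) * v \<le> measure lebesgue (X + Y)" .
  moreover have "measure lebesgue (X + Y) < v * 2 ^ DIM('a)"
    using v(1) by (simp only: pos_divide_less_eq zero_less_power zero_less_numeral)
  ultimately show False
    unfolding mult.commute[of v] by (rule leD[THEN notE])
qed

text \<open>The isodiametric inequality: if \<open>X\<close> has diameter at most \<open>2 * r\<close>, the difference set \<open>X - X\<close> lies in
the ball of radius \<open>2 * r\<close>, while its measure is at least \<open>2 ^ n\<close> times that of \<open>X\<close>.\<close>

lemma measure_open_diameter_le:
  fixes X :: "'a::euclidean_space set"
  assumes X: "open X" "bounded X" and diam: "\<And>x y. x \<in> X \<Longrightarrow> y \<in> X \<Longrightarrow> dist x y < 2 * r" and r: "r \<ge> 0"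
  shows "measure lebesgue X \<le> measure lebesgue (ball (0::'a) r)"
proof -
  have oX: "open (uminus ` X)" "bounded (uminus ` X)"
    using X open_negations[of X] by (simp_all add: bounded_uminus)
  have "measure lebesgue (uminus ` X) = measure lebesgue X"
    using measure_lebesgue_affine[of "-1" "0::'a" X] by (simp add: scaleR_minus_left)
  then have "2 ^ DIM('a) * measure lebesgue X \<le> measure lebesgue (X + uminus ` X)"
    using sumset_measure_ge_min[OF X oX] by simp
  also have "\<dots> \<le> measure lebesgue (ball (0::'a) (2 * r))"
  proof (rule measure_mono_fmeasurable)
    show "X + uminus ` X \<subseteq> ball 0 (2 * r)"
    proof
      fix z assume "z \<in> X + uminus ` X"
      then obtain x y where "x \<in> X" "y \<in> X" "z = x + - y" by (elim set_plus_elim imageE) metis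
      then show "z \<in> ball 0 (2 * r)" using diam[of y x] by (simp add: dist_norm)
    qed
    show "X + uminus ` X \<in> sets lebesgue"
      using lmeasurable_open[OF bounded_set_plus[OF X(2) oX(2)] open_set_plus[OF X(1)]]
      by (rule fmeasurableD)
  qed (rule lmeasurable_ball)
  also have "\<dots> = 2 ^ DIM('a) * measure lebesgue (ball (0::'a) r)"
    using content_ball_conv_unit_ball[of "2 * r" "0::'a"] content_ball_conv_unit_ball[of r "0::'a"] r
    by (simp add: power_mult_distrib)
  finally show ?thesis
    by (rule mult_left_le_imp_le) (rule zero_less_power[OF zero_less_numeral])
qed

section \<open>Growth of a set of diameter at most one under expansion\<close>

lemma outer_measure_of_UN_le:
  assumes "\<And>i. A i \<subseteq> space M"
  shows "outer_measure_of M (\<Union>i::nat. A i) \<le> (\<Sum>i. outer_measure_of M (A i))"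
proof -
  have "\<forall>i. \<exists>E. E \<in> sets M \<and> A i \<subseteq> E \<and> outer_measure_of M (A i) = emeasure M E"
    using outer_measure_of_attain[OF assms] by blast
  then obtain E where E: "\<And>i. E i \<in> sets M" "\<And>i. A i \<subseteq> E i"
      "\<And>i. outer_measure_of M (A i) = emeasure M (E i)"
    by metis
  have "outer_measure_of M (\<Union>i. A i) \<le> outer_measure_of M (\<Union>i. E i)"
    using E(2) by (intro outer_measure_of_mono) blast
  also have "\<dots> = emeasure M (\<Union>i. E i)" using E(1) by (intro outer_measure_of_eq) auto
  also have "\<dots> \<le> (\<Sum>i. emeasure M (E i))" using E(1) by (intro emeasure_subadditive_countably) auto
  finally show ?thesis by (simp add: E(3))
qed

lemma bounded_if_dist_less:
  fixes K :: "'a::metric_space set"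
  assumes "\<And>x y. x \<in> K \<Longrightarrow> y \<in> K \<Longrightarrow> dist x y < e"
  shows "bounded K"
proof (cases "K = {}")
  case False
  then obtain z where z: "z \<in> K" by blast
  have "K \<subseteq> ball z e" using assms z by auto
  then show ?thesis by (rule bounded_subset[OF bounded_ball])
qed simp

text \<open>Let \<open>X\<close> be the open \<open>\<eta>\<close>-neighbourhood of \<open>K\<close>. By the isodiametric inequality it is no larger than a
ball of radius \<open>1 / 2 + \<eta>\<close>, so the ball of radius \<open>1 / 2 - \<eta>\<close> has at least the measure of \<open>X\<close> up to a
factor close to 1. The Brunn-Minkowski inequality for \<open>X\<close> and this ball gives the claim. The margin
\<open>\<eta>\<close> replaces an arbitrary, perhaps non-measurable set by an open one.\<close>

lemma measure_expand_small_set: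
  fixes K :: "'a::euclidean_space set"
  assumes diam: "\<And>x y. x \<in> K \<Longrightarrow> y \<in> K \<Longrightarrow> dist x y < 1"
    and \<eta>: "0 < \<eta>" "\<eta> < 1 / 2"
  shows "2 ^ DIM('a) * (((1 / 2 - \<eta>) / (1 / 2 + \<eta>)) ^ DIM('a) * measure lebesgue (K + ball 0 \<eta>))
     \<le> measure lebesgue (K + ball 0 (1 / 2))"
proof -
  have bK: "bounded K" by (rule bounded_if_dist_less[OF diam])
  have plus_open: "open (K + ball 0 r)" for r
    using open_set_plus[of "ball 0 r" K] by (simp add: add.commute)
  have plus_bounded: "bounded (K + ball 0 r)" for r
    by (rule bounded_set_plus[OF bK bounded_ball])
  define X where "X = K + ball 0 \<eta>"
  define q where "q = (1 / 2 - \<eta>) / (1 / 2 + \<eta>)"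
  have q: "0 \<le> q" "q \<le> 1" using \<eta> by (simp_all add: q_def)
  have "measure lebesgue X \<le> measure lebesgue (ball (0::'a) (1 / 2 + \<eta>))"
  proof (rule measure_open_diameter_le)
    show "open X" "bounded X" unfolding X_def by (rule plus_open plus_bounded)+
    fix x y assume "x \<in> X" "y \<in> X"
    then obtain a u b v where "a \<in> K" "b \<in> K" "norm u < \<eta>" "norm v < \<eta>" "x = a + u" "y = b + v"
      unfolding X_def by (elim set_plus_elim) simp
    moreover from this have "dist a b < 1" using diam by blast
    ultimately show "dist x y < 2 * (1 / 2 + \<eta>)"
      using norm_triangle_ineq[of "a - b" "u - v"] norm_triangle_ineq4[of u v]
      by (simp add: dist_norm algebra_simps)
  qed (use \<eta> in simp)
  then have "q ^ DIM('a) * measure lebesgue X \<le> q ^ DIM('a) * measure lebesgue (ball (0::'a) (1 / 2 + \<eta>))"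
    using q by (intro mult_left_mono) auto
  also have "\<dots> = measure lebesgue (ball (0::'a) (1 / 2 - \<eta>))"
    using \<eta> content_ball_conv_unit_ball[of "1 / 2 - \<eta>" "0::'a"]
      content_ball_conv_unit_ball[of "1 / 2 + \<eta>" "0::'a"]
    by (simp add: q_def power_divide)
  finally have "q ^ DIM('a) * measure lebesgue X \<le> measure lebesgue (ball (0::'a) (1 / 2 - \<eta>))" .
  moreover have "q ^ DIM('a) * measure lebesgue X \<le> measure lebesgue X"
    using q by (intro mult_left_le_one_le) (auto simp: power_le_one)
  ultimately have "q ^ DIM('a) * measure lebesgue X
      \<le> min (measure lebesgue X) (measure lebesgue (ball (0::'a) (1 / 2 - \<eta>)))"
    by (rule min.boundedI[rotated])
  then have "2 ^ DIM('a) * (q ^ DIM('a) * measure lebesgue X)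
      \<le> 2 ^ DIM('a) * min (measure lebesgue X) (measure lebesgue (ball (0::'a) (1 / 2 - \<eta>)))"
    by (rule mult_left_mono) (rule zero_le_power[OF zero_le_numeral])
  also have "\<dots> \<le> measure lebesgue (X + ball 0 (1 / 2 - \<eta>))"
    unfolding X_def
    by (rule sumset_measure_ge_min[OF plus_open plus_bounded open_ball bounded_ball])
  also have "\<dots> \<le> measure lebesgue (K + ball 0 (1 / 2))"
  proof (rule measure_mono_fmeasurable)
    have "X + ball 0 (1 / 2 - \<eta>) = K + (ball 0 \<eta> + ball 0 (1 / 2 - \<eta>))"
      by (simp add: X_def add.assoc)
    also have "\<dots> \<subseteq> K + ball 0 (1 / 2)"
    proof (rule set_plus_mono2[OF order_refl], rule subsetI)
      fix z :: 'a assume "z \<in> ball 0 \<eta> + ball 0 (1 / 2 - \<eta>)"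
      then obtain u v where "norm u < \<eta>" "norm v < 1 / 2 - \<eta>" "z = u + v"
        by (elim set_plus_elim) simp
      then show "z \<in> ball 0 (1 / 2)" using norm_triangle_ineq[of u v] by simp
    qed
    finally show "X + ball 0 (1 / 2 - \<eta>) \<subseteq> K + ball 0 (1 / 2)" .
    show "X + ball 0 (1 / 2 - \<eta>) \<in> sets lebesgue"
      unfolding X_def
      by (rule fmeasurableD[OF lmeasurable_open[OF bounded_set_plus[OF plus_bounded bounded_ball]
              open_set_plus[OF plus_open]]])
    show "K + ball 0 (1 / 2) \<in> lmeasurable"
      by (rule lmeasurable_open[OF plus_bounded plus_open])
  qed
  finally show ?thesis unfolding X_def q_def .
qed

text \<open>The limit \<open>\<eta> \<rightarrow> 0\<close> of the previous estimate, since \<open>K + ball 0 \<eta>\<close> is an open set that covers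
\<open>K\<close>. Equality holds for balls of radius \<open>1 / 2\<close>, so the factor cannot be improved here.\<close>

lemma outer_measure_expand_small_set:
  fixes K :: "'a::euclidean_space set"
  assumes diam: "\<And>x y. x \<in> K \<Longrightarrow> y \<in> K \<Longrightarrow> dist x y < 1"
  shows "ennreal (2 ^ DIM('a)) * outer_measure_of lebesgue K \<le> emeasure lebesgue (K + ball 0 (1 / 2))"
proof -
  have bK: "bounded K" by (rule bounded_if_dist_less[OF diam])
  have lm: "K + ball 0 r \<in> lmeasurable" for r
    using lmeasurable_open[OF bounded_set_plus[OF bK bounded_ball]] open_set_plus[of "ball 0 r" K]
    by (simp add: add.commute)
  define b where "b = enn2real (outer_measure_of lebesgue K)"
  have le: "outer_measure_of lebesgue K \<le> ennreal (measure lebesgue (K + ball 0 r))" if "r > 0" for r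
  proof -
    have "K \<subseteq> K + ball 0 r"
      using that by (auto intro!: set_plus_intro[of _ K 0 "ball 0 r", simplified])
    then have "outer_measure_of lebesgue K \<le> outer_measure_of lebesgue (K + ball 0 r)"
      by (rule outer_measure_of_mono)
    also have "\<dots> = emeasure lebesgue (K + ball 0 r)"
      by (rule outer_measure_of_eq[OF fmeasurableD[OF lm]])
    also have "\<dots> = ennreal (measure lebesgue (K + ball 0 r))"
      by (rule emeasure_eq_measure2[OF lm])
    finally show ?thesis .
  qed
  have bK_eq: "outer_measure_of lebesgue K = ennreal b"
    using le[of 1] unfolding b_def by (simp add: le_less_trans[OF _ ennreal_less_top])
  have b_le: "b \<le> measure lebesgue (K + ball 0 r)" if "r > 0" for r
    using le[OF that] unfolding bK_eq by (simp add: ennreal_le_iff)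
  have "2 ^ DIM('a) * (((1 / 2 - 0) / (1 / 2 + 0)) ^ DIM('a) * b) \<le> measure lebesgue (K + ball 0 (1 / 2))"
  proof (rule tendsto_upperbound)
    show "((\<lambda>\<eta>::real. 2 ^ DIM('a) * (((1 / 2 - \<eta>) / (1 / 2 + \<eta>)) ^ DIM('a) * b))
        \<longlongrightarrow> 2 ^ DIM('a) * (((1 / 2 - 0) / (1 / 2 + 0)) ^ DIM('a) * b)) (at_right 0)"
      by (intro tendsto_intros) simp
    have "2 ^ DIM('a) * (((1 / 2 - \<eta>) / (1 / 2 + \<eta>)) ^ DIM('a) * b) \<le> measure lebesgue (K + ball 0 (1 / 2))"
      if "0 < \<eta>" "\<eta> < 1 / 2" for \<eta> :: real
    proof -
      have "2 ^ DIM('a) * (((1 / 2 - \<eta>) / (1 / 2 + \<eta>)) ^ DIM('a) * b)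
         \<le> 2 ^ DIM('a) * (((1 / 2 - \<eta>) / (1 / 2 + \<eta>)) ^ DIM('a) * measure lebesgue (K + ball 0 \<eta>))"
        using that b_le[of \<eta>] by (intro mult_left_mono zero_le_power divide_nonneg_nonneg) simp_all
      also have "\<dots> \<le> measure lebesgue (K + ball 0 (1 / 2))"
        by (rule measure_expand_small_set[OF diam that])
      finally show ?thesis .
    qed
    then show "\<forall>\<^sub>F \<eta> in at_right 0. 2 ^ DIM('a) * (((1 / 2 - \<eta>) / (1 / 2 + \<eta>)) ^ DIM('a) * b)
        \<le> measure lebesgue (K + ball 0 (1 / 2))"
      unfolding eventually_at_right_field by (intro exI[of _ "1 / 2"]) auto
  qed simp
  then have "2 ^ DIM('a) * b \<le> measure lebesgue (K + ball 0 (1 / 2))"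
    by (simp only: diff_zero add_0_right divide_self_if one_neq_zero power_one mult_1) simp
  then have "ennreal (2 ^ DIM('a) * b) \<le> ennreal (measure lebesgue (K + ball 0 (1 / 2)))"
    by (rule ennreal_leI)
  moreover have "ennreal (2 ^ DIM('a) * b) = ennreal (2 ^ DIM('a)) * outer_measure_of lebesgue K"
    unfolding bK_eq by (rule ennreal_mult') (rule zero_le_power[OF zero_le_numeral])
  ultimately show ?thesis using emeasure_eq_measure2[OF lm, of "1 / 2"] by simp
qed

section \<open>Gaps between blocks\<close>

text \<open>For vectors \<open>u, v, w\<close> from \<open>x\<close> to the three points, the squared distances between them sum to
\<open>3 * (|u|\<^sup>2 + |v|\<^sup>2 + |w|\<^sup>2) - |u + v + w|\<^sup>2\<close>, which is less than \<open>9 * s\<^sup>2 \<le> 3\<close>.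
So not all three distances exceed 1.\<close>

lemma no_three_far_points_near:
  fixes x a b c :: "'a::real_inner"
  assumes "dist x a < s" "dist x b < s" "dist x c < s" "s\<^sup>2 \<le> 1/3"
    and "dist a b > 1" "dist b c > 1" "dist a c > 1"
  shows False
proof -
  define u v w where "u = a - x" and "v = b - x" and "w = c - x"
  have s: "0 \<le> s" using assms(1) zero_le_dist[of x a] by linarith
  have "norm u < s" "norm v < s" "norm w < s"
    using assms(1-3) by (simp_all add: u_def v_def w_def dist_norm norm_minus_commute)
  then have "u \<bullet> u \<le> s\<^sup>2" "v \<bullet> v \<le> s\<^sup>2" "w \<bullet> w \<le> s\<^sup>2"
    using s by (simp_all add: power2_norm_eq_inner[symmetric] power_mono)
  moreover have "norm (u - v) > 1" "norm (v - w) > 1" "norm (u - w) > 1"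
    using assms(5-7) by (simp_all add: u_def v_def w_def dist_norm)
  then have "(u - v) \<bullet> (u - v) > 1" "(v - w) \<bullet> (v - w) > 1" "(u - w) \<bullet> (u - w) > 1"
    by (simp_all add: power2_norm_eq_inner[symmetric] one_less_power)
  moreover have "0 \<le> (u + v + w) \<bullet> (u + v + w)" by simp
  moreover have "(u + v + w) \<bullet> (u + v + w) + (u - v) \<bullet> (u - v) + (v - w) \<bullet> (v - w) + (u - w) \<bullet> (u - w)
      = 3 * (u \<bullet> u + v \<bullet> v + w \<bullet> w)"
    by (simp add: inner_add_left inner_add_right inner_diff_left inner_diff_right inner_commute)
  ultimately have "3 * (u \<bullet> u + v \<bullet> v + w \<bullet> w) > 3" "u \<bullet> u + v \<bullet> v + w \<bullet> w \<le> 3 * s\<^sup>2"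
    by argo+
  then show False using assms(4) by argo
qed

lemma negligible_closed_segment:
  fixes a b :: "'a::euclidean_space"
  assumes "2 \<le> DIM('a)"
  shows "negligible (closed_segment a b)"
  using interior_closed_segment_ge2[OF assms] negligible_convex_interior[of "closed_segment a b"] by simp

text \<open>A map that moves points by at most \<open>d\<close> cannot vacate the core of the ball: a preimage of \<open>y\<close> is a
fixed point of \<open>x \<mapsto> y + (x - g x)\<close>, which maps the ball to itself.\<close>

lemma Brouwer_small_displacement:
  fixes g :: "'a::euclidean_space \<Rightarrow> 'a"
  assumes g: "continuous_on (cball p r) g" and d: "\<And>x. x \<in> cball p r \<Longrightarrow> dist x (g x) \<le> d" and r: "0 < r"
  shows "cball p (r - d) \<subseteq> g ` cball p r"
proof
  fix y assume y: "y \<in> cball p (r - d)"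
  have "\<exists>x\<in>cball p r. g x = y"
  proof (rule brouwer_surjective_cball[OF g r y])
    fix u v assume u: "u \<in> cball p (r - d)" and v: "v \<in> cball p r"
    have "norm (p - (u + (v - g v))) \<le> norm (p - u) + norm (v - g v)"
      using norm_triangle_ineq4[of "p - u" "v - g v"] by (simp add: algebra_simps)
    then show "u + (v - g v) \<in> cball p r"
      using u d[OF v] by (simp add: dist_norm)
  qed
  then show "y \<in> g ` cball p r" by blast
qed

text \<open>Suppose that the neighbourhoods of radius \<open>11 / 20\<close> of the blocks cover the ball of
radius 2. At most two of them meet at any point, since \<open>(11 / 20)\<^sup>2 \<le> 1 / 3\<close>. A partition of unity subordinate to them, with one
chosen point \<open>c i\<close> per block, therefore defines a continuous map \<open>g\<close> with values on finitely many
segments, that is, on a null set because the dimension is at least two. On the other hand \<open>g\<close> moves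
a point by at most \<open>11 / 20 + 1 < 2\<close>, so its image contains a ball. In effect, this is
the Lebesgue covering theorem for coverings in which no three sets meet.\<close>

lemma exists_point_far_from_blocks:
  fixes B :: "nat \<Rightarrow> 'a::euclidean_space set"
  assumes dim: "2 \<le> DIM('a)"
    and same: "\<And>i x y. x \<in> B i \<Longrightarrow> y \<in> B i \<Longrightarrow> dist x y < 1"
    and diff: "\<And>i j x y. i \<noteq> j \<Longrightarrow> x \<in> B i \<Longrightarrow> y \<in> B j \<Longrightarrow> dist x y > 1"
  shows "\<exists>x\<in>cball p 2. \<forall>i. \<forall>a\<in>B i. 11 / 20 \<le> dist x a"
proof (rule ccontr)
  assume "\<not> ?thesis"
  then have near: "\<exists>i. \<exists>a\<in>B i. dist x a < 11 / 20" if "x \<in> cball p 2" for x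
    using that by (meson not_le)
  \<comment> \<open>Only blocks that meet this larger ball can come close to a point of the ball of radius 2.\<close>
  define J where "J = {i. B i \<inter> cball p 3 \<noteq> {}}"
  have "\<forall>i\<in>J. \<exists>a. a \<in> B i \<inter> cball p 3" by (auto simp: J_def)
  then obtain c where c: "\<And>i. i \<in> J \<Longrightarrow> c i \<in> B i \<inter> cball p 3" by metis
  have cdist: "dist (c i) (c j) > 1" if "i \<in> J" "j \<in> J" "i \<noteq> j" for i j
    using diff[OF that(3)] c that by blast
  have "uniform_discrete (c ` J)"
    unfolding uniform_discrete_def
  proof (intro exI[of _ 1] conjI ballI impI)
    fix x y assume "x \<in> c ` J" "y \<in> c ` J" and xy: "dist x y < 1"
    then obtain i j where "i \<in> J" "x = c i" "j \<in> J" "y = c j" by blast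
    then show "x = y" using cdist[of i j] xy by fastforce
  qed simp
  moreover have "bounded (c ` J)"
    by (rule bounded_subset[OF bounded_cball[of p 3]]) (use c in blast)
  ultimately have "finite (c ` J)" using uniform_discrete_finite_iff by blast
  moreover have "inj_on c J"
  proof (rule inj_onI, rule ccontr)
    fix i j assume "i \<in> J" "j \<in> J" "c i = c j" "i \<noteq> j"
    then show False using cdist[of i j] by simp
  qed
  ultimately have J: "finite J" using finite_imageD by blast
  define \<phi> where "\<phi> i x = max 0 (11 / 20 - infdist x (B i))" for i x
  have ne: "B i \<noteq> {}" if "i \<in> J" for i using c[OF that] by auto
  have \<phi>0: "0 \<le> \<phi> i x" for i x by (simp add: \<phi>_def)
  have active: "\<exists>a\<in>B i. dist x a < 11 / 20" if "i \<in> J" "\<phi> i x > 0" for i x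
  proof -
    have "infdist x (B i) < 11 / 20" using that(2) by (simp add: \<phi>_def split: if_splits)
    then show ?thesis using ne[OF that(1)] cInf_lessD[of "dist x ` B i" "11 / 20"]
      by (auto simp: infdist_def)
  qed
  have pos: "\<exists>i\<in>J. \<phi> i x > 0" if x: "x \<in> cball p 2" for x
  proof -
    obtain i a where a: "a \<in> B i" "dist x a < 11 / 20" using near[OF x] by blast
    have "dist p a \<le> 3" using dist_triangle[of p a x] a(2) x by simp
    then have "i \<in> J" using a(1) by (auto simp: J_def)
    moreover have "\<phi> i x > 0" using infdist_le[OF a(1), of x] a(2) by (simp add: \<phi>_def)
    ultimately show ?thesis by blast
  qed
  define \<Phi> where "\<Phi> x = (\<Sum>i\<in>J. \<phi> i x)" for x
  have \<Phi>: "\<Phi> x > 0" if "x \<in> cball p 2" for x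
    using pos[OF that] \<phi>0 J unfolding \<Phi>_def by (metis sum_pos2)
  define g where "g x = (\<Sum>i\<in>J. (\<phi> i x / \<Phi> x) *\<^sub>R c i)" for x
  have cont\<phi>: "continuous_on S (\<phi> i)" for S i
    unfolding \<phi>_def by (intro continuous_intros)
  have contg: "continuous_on (cball p 2) g"
    unfolding g_def
  proof (intro continuous_intros cont\<phi>)
    show "continuous_on (cball p 2) \<Phi>"
      unfolding \<Phi>_def by (intro continuous_intros cont\<phi>)
    show "\<forall>x\<in>cball p 2. \<Phi> x \<noteq> 0" using \<Phi> by (metis less_irrefl)
  qed
  have seg: "\<exists>i\<in>J. \<exists>j\<in>J. \<phi> i x > 0 \<and> \<phi> j x > 0 \<and> g x \<in> closed_segment (c i) (c j)"
    if x: "x \<in> cball p 2" for x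
  proof -
    obtain i where i: "i \<in> J" "\<phi> i x > 0" using pos[OF x] by blast
    obtain j where j: "j \<in> J" "\<phi> j x > 0" and rest: "\<And>k. k \<in> J \<Longrightarrow> k \<noteq> i \<Longrightarrow> k \<noteq> j \<Longrightarrow> \<phi> k x = 0"
    proof (cases "\<exists>j\<in>J. j \<noteq> i \<and> \<phi> j x > 0")
      case True
      then obtain j where j: "j \<in> J" "j \<noteq> i" "\<phi> j x > 0" by blast
      have "\<phi> k x = 0" if k: "k \<in> J" "k \<noteq> i" "k \<noteq> j" for k
      proof (rule ccontr)
        assume "\<phi> k x \<noteq> 0"
        then have "\<phi> k x > 0" using \<phi>0[of k x] by linarith
        then obtain a b d where abd: "a \<in> B i" "dist x a < 11 / 20" "b \<in> B j" "dist x b < 11 / 20"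
          "d \<in> B k" "dist x d < 11 / 20"
          using active i j k by meson
        show False
          by (rule no_three_far_points_near[OF abd(2,4,6) _ diff[OF _ abd(1,3)] diff[OF _ abd(3,5)] diff[OF _ abd(1,5)]])
            (use j(2) k in \<open>auto simp: power2_eq_square\<close>)
      qed
      then show thesis using that j by blast
    next
      case False
      have "\<phi> k x = 0" if "k \<in> J" "k \<noteq> i" for k
        using \<phi>0[of k x] False that order_le_less[of 0 "\<phi> k x"] by auto
      then show thesis using that i by blast
    qed
    have gx: "g x = (\<Sum>k\<in>{i, j}. (\<phi> k x / \<Phi> x) *\<^sub>R c k)"
      unfolding g_def by (rule sum.mono_neutral_right) (use J i j rest in auto)
    have \<Phi>x: "\<Phi> x = (\<Sum>k\<in>{i, j}. \<phi> k x)"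
      unfolding \<Phi>_def by (rule sum.mono_neutral_right) (use J i j rest in auto)
    have "g x \<in> closed_segment (c i) (c j)"
    proof (cases "i = j")
      case True
      then show ?thesis using gx \<Phi>x i(2) by simp
    next
      case False
      define u where "u = \<phi> j x / \<Phi> x"
      have "0 \<le> u" "u \<le> 1" "\<phi> i x / \<Phi> x = 1 - u"
        using False \<Phi>x i(2) j(2) by (auto simp: u_def field_simps)
      moreover have "g x = (1 - u) *\<^sub>R c i + u *\<^sub>R c j"
        using gx False \<open>\<phi> i x / \<Phi> x = 1 - u\<close> by (simp add: u_def)
      ultimately show ?thesis by (auto simp: in_segment)
    qed
    then show ?thesis using i j by blast
  qed
  have disp: "dist x (g x) \<le> 31 / 20" if x: "x \<in> cball p 2" for x
  proof -
    have close: "c i \<in> cball x (31 / 20)" if i: "i \<in> J" "\<phi> i x > 0" for i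
    proof -
      obtain a where a: "a \<in> B i" "dist x a < 11 / 20" using active[OF i] by blast
      have "dist a (c i) < 1" using same a(1) c[OF i(1)] by blast
      then show ?thesis using dist_triangle[of x "c i" a] a(2) by simp
    qed
    obtain i j where ij: "i \<in> J" "\<phi> i x > 0" "j \<in> J" "\<phi> j x > 0" "g x \<in> closed_segment (c i) (c j)"
      using seg[OF x] by blast
    have "closed_segment (c i) (c j) \<subseteq> cball x (31 / 20)"
      by (rule closed_segment_subset[OF close[OF ij(1,2)] close[OF ij(3,4)] convex_cball])
    then show ?thesis using ij(5) by auto
  qed
  have "cball p (2 - 31 / 20) \<subseteq> g ` cball p 2"
    by (rule Brouwer_small_displacement[OF contg disp]) simp_all
  also have "\<dots> \<subseteq> (\<Union>(i, j)\<in>J \<times> J. closed_segment (c i) (c j))"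
    using seg by fastforce
  finally have "cball p (2 - 31 / 20) \<subseteq> (\<Union>(i, j)\<in>J \<times> J. closed_segment (c i) (c j))" .
  moreover have "negligible (\<Union>(i, j)\<in>J \<times> J. closed_segment (c i) (c j))"
  proof (rule negligible_Union)
    show "finite ((\<lambda>(i, j). closed_segment (c i) (c j)) ` (J \<times> J))" using J by simp
  qed (use negligible_closed_segment[OF dim] in auto)
  ultimately have "negligible (ball p (2 - 31 / 20))"
    using negligible_subset ball_subset_cball by (metis subset_trans)
  then show False using open_not_negligible[of "ball p (2 - 31 / 20)"] by simp
qed

section \<open>Averaging local measure bounds\<close>

text \<open>Averaging: integrate the measure of \<open>H \<inter> ball p R\<close> over \<open>p \<in> S\<close> and exchange the order of
integration. Each point of \<open>H\<close> then counts for the centres within distance \<open>R\<close> of it, which form at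
most one ball.\<close>

lemma emeasure_ge_of_uniform_local_bound:
  fixes H S T :: "'a::euclidean_space set"
  assumes [measurable]: "H \<in> sets borel" "S \<in> sets borel" "T \<in> sets borel"
    and R: "R \<ge> 0"
    and loc: "\<And>p. c \<le> emeasure lborel (H \<inter> ball p R)"
    and sub: "\<And>p. p \<in> S \<Longrightarrow> ball p R \<subseteq> T"
  shows "c * emeasure lborel S \<le> emeasure lborel (H \<inter> T) * emeasure lborel (ball (0::'a) R)"
proof -
  define D where "D = {z::'a \<times> 'a. dist (fst z) (snd z) < R}"
  have "open D" unfolding D_def by (intro open_Collect_less continuous_intros)
  then have [measurable]: "D \<in> sets (lborel \<Otimes>\<^sub>M lborel)"
    by (metis borel_open borel_prod sets_lborel sets_pair_measure_cong)
  have "c * emeasure lborel S = (\<integral>\<^sup>+p. c * indicator S p \<partial>lborel)"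
    by (simp add: nn_integral_cmult)
  also have "\<dots> \<le> (\<integral>\<^sup>+p. (\<integral>\<^sup>+x. indicator S p * indicator H x * indicator D (p, x) \<partial>lborel) \<partial>lborel)"
  proof (rule nn_integral_mono)
    fix p :: 'a
    have "(\<integral>\<^sup>+x. indicator S p * indicator H x * indicator D (p, x) \<partial>lborel)
        = (\<integral>\<^sup>+x. indicator S p * indicator (H \<inter> ball p R) x \<partial>lborel)"
      by (intro nn_integral_cong) (auto simp: D_def indicator_def)
    also have "\<dots> = indicator S p * emeasure lborel (H \<inter> ball p R)"
      using assms(1) by (subst nn_integral_cmult) (auto intro!: borel_measurable_indicator)
    finally show "c * indicator S p \<le> (\<integral>\<^sup>+x. indicator S p * indicator H x * indicator D (p, x) \<partial>lborel)"
      using loc[of p] by (simp add: indicator_def)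
  qed
  also have "\<dots> = (\<integral>\<^sup>+x. (\<integral>\<^sup>+p. indicator S p * indicator H x * indicator D (p, x) \<partial>lborel) \<partial>lborel)"
    by (rule lborel_pair.Fubini') measurable
  also have "\<dots> \<le> (\<integral>\<^sup>+x. indicator (H \<inter> T) x * emeasure lborel (ball (0::'a) R) \<partial>lborel)"
  proof (rule nn_integral_mono)
    fix x :: 'a
    have "(\<integral>\<^sup>+p. indicator S p * indicator H x * indicator D (p, x) \<partial>lborel)
        \<le> (\<integral>\<^sup>+p. indicator (H \<inter> T) x * indicator (ball x R) p \<partial>lborel)"
      using sub by (intro nn_integral_mono) (auto simp: D_def indicator_def dist_commute subset_iff)
    also have "\<dots> = indicator (H \<inter> T) x * emeasure lborel (ball x R)"
      by (subst nn_integral_cmult) (auto intro!: borel_measurable_indicator)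
    also have "emeasure lborel (ball x R) = emeasure lborel (ball (0::'a) R)"
      using emeasure_ball[of R x] emeasure_ball[of R "0::'a"] R by simp
    finally show "(\<integral>\<^sup>+p. indicator S p * indicator H x * indicator D (p, x) \<partial>lborel)
        \<le> indicator (H \<inter> T) x * emeasure lborel (ball (0::'a) R)" .
  qed
  also have "\<dots> = emeasure lborel (H \<inter> T) * emeasure lborel (ball (0::'a) R)"
    by (simp add: nn_integral_multc)
  finally show ?thesis .
qed


section \<open>Density of sets with block structure\<close>

lemma set_plus_ball_iff:
  fixes K :: "'a::real_normed_vector set"
  shows "y \<in> K + ball 0 r \<longleftrightarrow> (\<exists>a\<in>K. dist y a < r)"
proof
  assume "y \<in> K + ball 0 r"
  then obtain a u where "a \<in> K" "norm u < r" "y = a + u" by (elim set_plus_elim) simp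
  then show "\<exists>a\<in>K. dist y a < r" by (intro bexI[of _ a]) (simp_all add: dist_norm)
next
  assume "\<exists>a\<in>K. dist y a < r"
  then obtain a where "a \<in> K" "y - a \<in> ball 0 r" by (auto simp: dist_norm norm_minus_commute)
  then have "a + (y - a) \<in> K + ball 0 r" by (rule set_plus_intro)
  then show "y \<in> K + ball 0 r" by simp
qed

definition block_nbhd :: "(nat \<Rightarrow> 'a::euclidean_space set) \<Rightarrow> 'a set" where
  "block_nbhd B = (\<Union>i. B i + ball 0 (1 / 2))"

lemma open_block_nbhd: "open (block_nbhd B)"
  unfolding block_nbhd_def
  using open_set_plus[of "ball 0 (1 / 2)"] by (intro open_UN ballI) (simp add: add.commute)

text \<open>The neighbourhoods of different blocks are disjoint since the blocks are more than 1 apart, so the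
expansion estimates for the single blocks add up. It is enough to expand the part of each block inside
the cube; then the neighbourhoods stay in a slightly larger cube.\<close>

lemma outer_measure_Int_cube_le:
  fixes B :: "nat \<Rightarrow> (real^'n) set"
  assumes same: "\<And>i x y. x \<in> B i \<Longrightarrow> y \<in> B i \<Longrightarrow> dist x y < 1"
    and diff: "\<And>i j x y. i \<noteq> j \<Longrightarrow> x \<in> B i \<Longrightarrow> y \<in> B j \<Longrightarrow> dist x y > 1"
  shows "ennreal (2 ^ CARD('n)) * outer_measure_of lebesgue ((\<Union>i. B i) \<inter> cube p r)
    \<le> emeasure lborel (block_nbhd B \<inter> cube p (r + 3))"
proof -
  define N where "N i = (B i \<inter> cube p r) + ball 0 (1 / 2)" for i
  have N: "N i \<in> sets borel" for i
    unfolding N_def using open_set_plus[of "ball 0 (1 / 2)" "B i \<inter> cube p r"]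
    by (simp add: add.commute)
  have disj: "disjoint_family N"
  proof (unfold disjoint_family_on_def, intro ballI impI, rule ccontr)
    fix i j :: nat assume "i \<noteq> j" "N i \<inter> N j \<noteq> {}"
    then obtain y a b where "a \<in> B i" "b \<in> B j" "dist y a < 1 / 2" "dist y b < 1 / 2"
      unfolding N_def by (auto simp: set_plus_ball_iff)
    then show False using diff[OF \<open>i \<noteq> j\<close>, of a b] dist_triangle_half_r[of y a 1 b] by auto
  qed
  have "(\<Union>i. B i) \<inter> cube p r = (\<Union>i. B i \<inter> cube p r)" by blast
  then have "ennreal (2 ^ CARD('n)) * outer_measure_of lebesgue ((\<Union>i. B i) \<inter> cube p r)
      \<le> ennreal (2 ^ CARD('n)) * (\<Sum>i. outer_measure_of lebesgue (B i \<inter> cube p r))"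
    using outer_measure_of_UN_le[of "\<lambda>i. B i \<inter> cube p r" lebesgue] by (intro mult_left_mono) auto
  also have "\<dots> = (\<Sum>i. ennreal (2 ^ CARD('n)) * outer_measure_of lebesgue (B i \<inter> cube p r))"
    by (rule ennreal_suminf_cmult[symmetric])
  also have "\<dots> \<le> (\<Sum>i. emeasure lborel (N i))"
  proof (intro suminf_le allI)
    fix i
    have "ennreal (2 ^ DIM(real^'n)) * outer_measure_of lebesgue (B i \<inter> cube p r)
        \<le> emeasure lebesgue (B i \<inter> cube p r + ball 0 (1 / 2))"
      by (rule outer_measure_expand_small_set) (use same in blast)
    then show "ennreal (2 ^ CARD('n)) * outer_measure_of lebesgue (B i \<inter> cube p r) \<le> emeasure lborel (N i)"
      using N[of i] by (simp add: N_def)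
  qed auto
  also have "\<dots> = emeasure lborel (\<Union>i. N i)"
    using N disj by (intro suminf_emeasure) auto
  also have "\<dots> \<le> emeasure lborel (block_nbhd B \<inter> cube p (r + 3))"
  proof (rule emeasure_mono)
    have "y \<in> cube p (r + 3)" if "a \<in> cube p r" "dist y a < 1 / 2" for y a
      unfolding cube_def
    proof (intro CollectI allI)
      fix i
      have "\<bar>y $ i - a $ i\<bar> \<le> dist y a" using component_le_norm_cart[of "y - a" i] by (simp add: dist_norm)
      moreover have "\<bar>a $ i - p $ i\<bar> \<le> r" using that(1) by (simp add: cube_def)
      ultimately show "\<bar>y $ i - p $ i\<bar> \<le> r + 3" using that(2) by linarith
    qed
    then show "(\<Union>i. N i) \<subseteq> block_nbhd B \<inter> cube p (r + 3)"
      by (fastforce simp: N_def block_nbhd_def set_plus_ball_iff)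
    show "block_nbhd B \<inter> cube p (r + 3) \<in> sets lborel"
      using open_block_nbhd[of B] by (simp add: cube_eq_cbox)
  qed
  finally show ?thesis .
qed

lemma emeasure_lborel_cube:
  fixes p :: "real^'n"
  assumes "r \<ge> 0"
  shows "emeasure lborel (cube p r) = ennreal ((2 * r) ^ CARD('n))"
  using emeasure_cube[OF assms, of p] by (simp add: cube_eq_cbox)

text \<open>Every ball of radius 3 contains a ball of radius \<open>1 / 20 = 11 / 20 - 1 / 2\<close> that avoids the
neighbourhoods, and \<open>(1 / 60) ^ n\<close> is the ratio of the volumes of these two balls.\<close>

lemma emeasure_complement_block_nbhd_ge:
  fixes B :: "nat \<Rightarrow> (real^'n) set"
  assumes dim: "2 \<le> CARD('n)"
    and same: "\<And>i x y. x \<in> B i \<Longrightarrow> y \<in> B i \<Longrightarrow> dist x y < 1"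
    and diff: "\<And>i j x y. i \<noteq> j \<Longrightarrow> x \<in> B i \<Longrightarrow> y \<in> B j \<Longrightarrow> dist x y > 1"
    and r: "r \<ge> 0"
  shows "ennreal ((1 / 60) ^ CARD('n) * (2 * r) ^ CARD('n)) \<le> emeasure lborel (- block_nbhd B \<inter> cube p (r + 3))"
proof -
  let ?n = "CARD('n)" and ?\<kappa> = "unit_ball_vol (real CARD('n))"
  have \<kappa>: "?\<kappa> > 0" by (rule unit_ball_vol_pos) simp
  have ball_vol: "emeasure lborel (ball x s) = ennreal (?\<kappa> * s ^ ?n)" if "s \<ge> 0" for x :: "real^'n" and s
    using emeasure_ball[OF that, of x] by simp
  have loc: "ennreal (?\<kappa> * (1 / 20) ^ ?n) \<le> emeasure lborel (- block_nbhd B \<inter> ball q 3)" for q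
  proof -
    obtain x where x: "x \<in> cball q 2" "\<And>i a. a \<in> B i \<Longrightarrow> 11 / 20 \<le> dist x a"
      using exists_point_far_from_blocks[of B q] dim same diff by auto
    have "ball x (1 / 20) \<subseteq> - block_nbhd B \<inter> ball q 3"
    proof
      fix y assume y: "y \<in> ball x (1 / 20)"
      have "y \<notin> block_nbhd B"
      proof
        assume "y \<in> block_nbhd B"
        then obtain i a where "a \<in> B i" "dist y a < 1 / 2"
          by (auto simp: block_nbhd_def set_plus_ball_iff)
        then show False using x(2)[of a i] dist_triangle[of x a y] y by simp
      qed
      moreover have "dist q y < 3" using dist_triangle[of q y x] x(1) y by simp
      ultimately show "y \<in> - block_nbhd B \<inter> ball q 3" by simp
    qed
    then have "emeasure lborel (ball x (1 / 20)) \<le> emeasure lborel (- block_nbhd B \<inter> ball q 3)"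
      using open_block_nbhd[of B] by (intro emeasure_mono) auto
    then show ?thesis using ball_vol[of "1 / 20" x] by simp
  qed
  have sub: "ball q 3 \<subseteq> cube p (r + 3)" if q: "q \<in> cube p r" for q
  proof
    fix y assume y: "y \<in> ball q 3"
    show "y \<in> cube p (r + 3)"
      unfolding cube_def
    proof (intro CollectI allI)
      fix i
      have "\<bar>y $ i - q $ i\<bar> \<le> dist q y"
        using component_le_norm_cart[of "y - q" i] by (simp add: dist_norm norm_minus_commute)
      moreover have "\<bar>q $ i - p $ i\<bar> \<le> r" using q by (simp add: cube_def)
      ultimately show "\<bar>y $ i - p $ i\<bar> \<le> r + 3" using y by simp
    qed
  qed
  have "ennreal (?\<kappa> * (1 / 20) ^ ?n) * emeasure lborel (cube p r)
      \<le> emeasure lborel (- block_nbhd B \<inter> cube p (r + 3)) * emeasure lborel (ball (0::real^'n) 3)"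
    by (rule emeasure_ge_of_uniform_local_bound[OF _ _ _ _ loc sub])
      (use open_block_nbhd[of B] in \<open>auto simp: cube_eq_cbox\<close>)
  then have "ennreal (?\<kappa> * (1 / 20) ^ ?n) * ennreal ((2 * r) ^ ?n)
      \<le> emeasure lborel (- block_nbhd B \<inter> cube p (r + 3)) * ennreal (?\<kappa> * 3 ^ ?n)"
    using emeasure_lborel_cube[OF r, of p] ball_vol[of 3 0] by simp
  moreover have "ennreal (?\<kappa> * (1 / 20) ^ ?n) * ennreal ((2 * r) ^ ?n)
      = ennreal ((1 / 60) ^ ?n * (2 * r) ^ ?n) * ennreal (?\<kappa> * 3 ^ ?n)"
  proof -
    have "(1 / 20 :: real) ^ ?n = (1 / 60) ^ ?n * 3 ^ ?n"
      unfolding power_mult_distrib[symmetric] by simp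
    then have "?\<kappa> * (1 / 20) ^ ?n * (2 * r) ^ ?n = (1 / 60) ^ ?n * (2 * r) ^ ?n * (?\<kappa> * 3 ^ ?n)"
      by (simp only: mult_ac)
    moreover have "0 \<le> ?\<kappa> * (1 / 20) ^ ?n" "0 \<le> (1 / 60) ^ ?n * (2 * r) ^ ?n"
      using \<kappa> r by (intro mult_nonneg_nonneg zero_le_power; simp)+
    ultimately show ?thesis by (simp only: ennreal_mult'[symmetric])
  qed
  ultimately have "ennreal (?\<kappa> * 3 ^ ?n) * ennreal ((1 / 60) ^ ?n * (2 * r) ^ ?n)
      \<le> ennreal (?\<kappa> * 3 ^ ?n) * emeasure lborel (- block_nbhd B \<inter> cube p (r + 3))"
    by (simp only: mult.commute)
  moreover have "ennreal (?\<kappa> * 3 ^ ?n) \<noteq> 0" "ennreal (?\<kappa> * 3 ^ ?n) \<noteq> top"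
    using \<kappa> by (simp_all add: ennreal_eq_0_iff not_le)
  ultimately show ?thesis
    by (simp add: ennreal_mult_le_mult_iff)
qed

lemma density_ratio_le:
  fixes B :: "nat \<Rightarrow> (real^'n) set"
  assumes dim: "2 \<le> CARD('n)"
    and same: "\<And>i x y. x \<in> B i \<Longrightarrow> y \<in> B i \<Longrightarrow> dist x y < 1"
    and diff: "\<And>i j x y. i \<noteq> j \<Longrightarrow> x \<in> B i \<Longrightarrow> y \<in> B j \<Longrightarrow> dist x y > 1"
    and r: "r > 0"
  shows "enn2real (outer_measure_of lebesgue ((\<Union>i. B i) \<inter> cube p r)) / (2 * r) ^ CARD('n)
    \<le> ((1 + 3 / r) ^ CARD('n) - (1 / 60) ^ CARD('n)) / 2 ^ CARD('n)"
proof -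
  let ?n = "CARD('n)" and ?Q = "cube p (r + 3)"
  define a where "a = enn2real (outer_measure_of lebesgue ((\<Union>i. B i) \<inter> cube p r))"
  define f where "f = measure lborel (block_nbhd B \<inter> ?Q)"
  define h where "h = measure lborel (- block_nbhd B \<inter> ?Q)"
  have a: "outer_measure_of lebesgue ((\<Union>i. B i) \<inter> cube p r) = ennreal a"
  proof -
    have "outer_measure_of lebesgue ((\<Union>i. B i) \<inter> cube p r) < top"
      using outer_measure_cube_le[of "\<Union>i. B i" p r] emeasure_cube[of r p] r
      by (simp add: le_less_trans[OF _ ennreal_less_top])
    then show ?thesis by (simp add: a_def)
  qed
  have a0: "0 \<le> a" by (simp add: a_def)
  have Q: "?Q \<in> fmeasurable lborel" by (simp add: cube_eq_cbox)
  have N: "block_nbhd B \<in> sets lborel" using open_block_nbhd[of B] by simp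
  have NQ: "block_nbhd B \<inter> ?Q \<in> fmeasurable lborel" "- block_nbhd B \<inter> ?Q \<in> fmeasurable lborel"
    using fmeasurable_Int_fmeasurable[OF Q] N by (auto simp: Int_commute)
  have "ennreal (2 ^ ?n * a) \<le> ennreal f"
    using outer_measure_Int_cube_le[of B p r] same diff emeasure_eq_measure2[OF NQ(1)] a
    by (simp add: f_def ennreal_mult')
  then have af: "2 ^ ?n * a \<le> f" by (simp add: f_def)
  have "ennreal ((1 / 60) ^ ?n * (2 * r) ^ ?n) \<le> ennreal h"
    using emeasure_complement_block_nbhd_ge[OF dim, of B r p] same diff r emeasure_eq_measure2[OF NQ(2)]
    by (simp add: h_def)
  then have h: "(1 / 60) ^ ?n * (2 * r) ^ ?n \<le> h" by (simp add: h_def)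
  have "f + h = measure lborel ?Q"
  proof -
    have "(block_nbhd B \<inter> ?Q) \<inter> (- block_nbhd B \<inter> ?Q) = {}" by blast
    then have "measure lborel ((block_nbhd B \<inter> ?Q) \<union> (- block_nbhd B \<inter> ?Q)) = f + h"
      unfolding f_def h_def using measure_Un3[OF NQ] by simp
    moreover have "(block_nbhd B \<inter> ?Q) \<union> (- block_nbhd B \<inter> ?Q) = ?Q" by blast
    ultimately show ?thesis by simp
  qed
  also have "\<dots> = (2 * (r + 3)) ^ ?n"
    using emeasure_lborel_cube[of "r + 3" p] r by (simp add: measure_def)
  also have "\<dots> = (2 * r) ^ ?n * (1 + 3 / r) ^ ?n"
    unfolding power_mult_distrib[symmetric] by (rule arg_cong[where f = "\<lambda>t. t ^ ?n"]) (use r in \<open>simp add: field_simps\<close>)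
  finally have fh: "f + h = (2 * r) ^ ?n * (1 + 3 / r) ^ ?n" .
  have "2 ^ ?n * a \<le> (2 * r) ^ ?n * ((1 + 3 / r) ^ ?n - (1 / 60) ^ ?n)"
    using af fh h by (simp only: right_diff_distrib mult.commute[of "(1 / 60) ^ ?n"]) 
  moreover have "x / P \<le> d / T" if "T * x \<le> P * d" "P > 0" "T > 0" for x P d T :: real
    using that by (simp add: field_simps)
  ultimately show ?thesis
    unfolding a_def[symmetric] using r by simp
qed

theorem theorem2p1:
  assumes "CARD('n::finite) \<ge> 2"
  shows "\<exists>\<epsilon>::real. \<epsilon> > 0 \<and>
    (\<forall>A :: (real^'n) set. one_avoiding A \<longrightarrow> has_block_structure A \<longrightarrow>
       upper_density A \<le> ereal (1 / 2 ^ CARD('n) - \<epsilon>))"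
proof (intro exI[of _ "(1 / 60) ^ CARD('n) / 2 ^ CARD('n)"] conjI allI impI)
  let ?n = "CARD('n)"
  show "(0::real) < (1 / 60) ^ ?n / 2 ^ ?n" by (intro divide_pos_pos zero_less_power) simp_all
  fix A :: "(real^'n) set"
  assume "has_block_structure A"
  then obtain B :: "nat \<Rightarrow> (real^'n) set" where A: "A = (\<Union>i. B i)"
    and same: "\<And>i x y. x \<in> B i \<Longrightarrow> y \<in> B i \<Longrightarrow> dist x y < 1"
    and diff: "\<And>i j x y. i \<noteq> j \<Longrightarrow> x \<in> B i \<Longrightarrow> y \<in> B j \<Longrightarrow> dist x y > 1"
    unfolding has_block_structure_def by metis
  define b where "b r = ((1 + 3 / r) ^ ?n - (1 / 60) ^ ?n) / 2 ^ ?n" for r :: real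
  have "upper_density A \<le> Limsup at_top (\<lambda>r. ereal (b r))"
    unfolding upper_density_def upper_density_at_def
  proof (rule Limsup_mono)
    show "\<forall>\<^sub>F r in at_top. enn2ereal (outer_measure_of lebesgue (A \<inter> cube 0 r)
        / emeasure lebesgue (cube 0 r :: (real^'n) set)) \<le> ereal (b r)"
      using eventually_gt_at_top[of "0::real"]
    proof eventually_elim
      case (elim r)
      show ?case
        unfolding density_ratio_eq[OF elim] A b_def
        using density_ratio_le[OF assms same diff elim, where p = 0] by (simp only: ereal_less_eq)
    qed
  qed
  also have "\<dots> = ereal (((1 + 0) ^ ?n - (1 / 60) ^ ?n) / 2 ^ ?n)"
  proof (rule lim_imp_Limsup)
    have "((\<lambda>r::real. 3 / r) \<longlongrightarrow> 0) at_top"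
      by (intro real_tendsto_divide_at_top[OF tendsto_const filterlim_ident])
    then show "((\<lambda>r. ereal (b r)) \<longlongrightarrow> ereal (((1 + 0) ^ ?n - (1 / 60) ^ ?n) / 2 ^ ?n)) at_top"
      unfolding b_def by (intro tendsto_intros) simp_all
  qed simp
  also have "((1 + 0) ^ ?n - (1 / 60) ^ ?n) / 2 ^ ?n = 1 / 2 ^ ?n - (1 / 60) ^ ?n / (2::real) ^ ?n"
    by (simp only: add_0_right power_one diff_divide_distrib)
  finally show "upper_density A \<le> ereal (1 / 2 ^ ?n - (1 / 60) ^ ?n / 2 ^ ?n)" .
qed

end
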